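(* Let $F$ be a finite field of characteristic $p$ with $|F|=q=p^k$ and let $G=C_{2}^3 \times C_3$. (1) If $p=2$, then $$U(FG) \cong \begin{cases} C_2^{21k} \times C_{2^k-1}^{3}, & \text{if } q \equiv 1 \bmod 3;\\ C_2^{21k} \times C_{2^k-1} \times C_{2^{2k}-1}, & \text{if } q \equiv -1 \bmod 3.\end{cases}$$ (2) If $p=3$, then $U(FG) \cong C_{3}^{16k} \times C_{3^k-1}^8$. (3) If $p>3$, then $$U(FG) \cong \begin{cases} C_{p^k-1}^{24}, & \text{if } q \equiv 1 \bmod 6;\\ C_{p^k-1}^{8} \times C_{p^{2k}-1}^{8}, & \text{if } q \equiv -1 \bmod 6.\end{cases}$$
   Context: $FG$ denotes the group algebra of a finite group $G$ over $F$, and $U(FG)$ its group of units. $C_n$ is the cyclic group of order $n$, and $C_n^m$ is the direct product of $m$ copies of $C_n$. *)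

theory Defs
  imports
    "HOL-Algebra.Ring"
    "HOL-Algebra.Product_Groups"
    "HOL-Number_Theory.Cong"
begin

definition ring_char :: "('a, 'm) ring_scheme \<Rightarrow> nat" where
  "ring_char R =
     (if \<exists>n::nat. n > 0 \<and> [n] \<cdot>\<^bsub>R\<^esub> \<one>\<^bsub>R\<^esub> = \<zero>\<^bsub>R\<^esub>
      then LEAST n::nat. n > 0 \<and> [n] \<cdot>\<^bsub>R\<^esub> \<one>\<^bsub>R\<^esub> = \<zero>\<^bsub>R\<^esub>
      else 0)"

(* An element a of the carrier stands for the formal sum of the terms (a g) g over g in G.
   The product is convolution: the coefficient of g collects all pairs (h, k) with h k = g,
   i.e. k = inv h * g.  Only meant for finite G: supports are not restricted. *)
definition group_algebra ::
  "('a, 'm) ring_scheme \<Rightarrow> ('g, 'n) monoid_scheme \<Rightarrow> ('g \<Rightarrow> 'a) ring" where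
  "group_algebra F G =
     \<lparr>carrier = carrier G \<rightarrow>\<^sub>E carrier F,
      monoid.mult = (\<lambda>a b. \<lambda>g\<in>carrier G.
                \<Oplus>\<^bsub>F\<^esub>h\<in>carrier G. a h \<otimes>\<^bsub>F\<^esub> b (inv\<^bsub>G\<^esub> h \<otimes>\<^bsub>G\<^esub> g)),
      one = (\<lambda>g\<in>carrier G. if g = \<one>\<^bsub>G\<^esub> then \<one>\<^bsub>F\<^esub> else \<zero>\<^bsub>F\<^esub>),
      zero = (\<lambda>g\<in>carrier G. \<zero>\<^bsub>F\<^esub>),
      add = (\<lambda>a b. \<lambda>g\<in>carrier G. a g \<oplus>\<^bsub>F\<^esub> b g)\<rparr>"

(* C_n^m, with C_n the additive group of integers modulo n *)
definition cyclic_power :: "nat \<Rightarrow> nat \<Rightarrow> (nat \<Rightarrow> int) monoid" where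
  "cyclic_power n m = product_group {..<m} (\<lambda>_. integer_mod_group n)"

end

(*
  F[C_2 x H] is S[X]/(X^2 - 1) over S = F[H], so F[G] is a tower of three such extensions over
  S = F[C_3] = F[X]/(X^3 - 1).

  If 2 is invertible, evaluation at 1 and -1 identifies S[X]/(X^2 - 1) with S x S.  In characteristic 2
  its unit group is U(S) times the additive group of S, since (1 + X)^2 = 0.

  If 3 is invertible, F[C_3] is F x F[w] with w^2 + w + 1 = 0, and F[w] is F x F or the field with q^2
  elements, according to q mod 3.  In characteristic 3, X - 1 is nilpotent of order 3 and U(F[C_3]) is
  U(F) times two copies of the additive group of F.

  The additive groups are elementary abelian, hence determined by their order, and the unit groups
  of the finite fields are cyclic.
*)
theory Submission
  imports Defs "HOL-Algebra.Multiplicative_Group" "HOL-Algebra.QuotRing"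
    "HOL-Decision_Procs.Commutative_Ring" "HOL-Library.Reflection"
begin

section \<open>Isomorphisms of unit groups and products\<close>

text \<open>No quotient rings are formed. The extensions are coordinate tuples with an explicit
  multiplication, so ring laws and homomorphism properties become polynomial identities in the
  coordinates, decided by normalisation. The normaliser knows only the laws of commutative rings; a
  relation such as 2 = 0 or the equation of \<omega> enters through an explicit cofactor.

  C_3 sits at the bottom because U(F[C_3]) is computed directly over the field F. From F[C_3] on
  nothing is a field, so the C_2 step is proved over arbitrary commutative rings and in a form that
  applies to its own result.

  Origin of the exponents: if 2 is invertible, three steps double every exponent three times, whence
  24 = 8 * 3 and 16k = 8 * 2k. In characteristic 2 the steps contribute the additive groups of S,
  S[C_2] and S[C_2^2], of ranks 3k, 6k and 12k, in total 21k.

  For p > 3 the residue of q modulo 6 enters only through its residue modulo 3.\<close>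

lemma is_isoI_inj_card:
  assumes "h \<in> hom G H" "inj_on h (carrier G)" "card (carrier G) = card (carrier H)"
    "finite (carrier H)"
  shows "G \<cong> H"
proof -
  have "h ` carrier G \<subseteq> carrier H"
    using assms(1) by (auto simp: hom_def)
  then have "h ` carrier G = carrier H"
    using assms(2-4) by (metis card_image card_subset_eq)
  then show ?thesis
    using assms by (intro is_isoI isoI) (auto simp: bij_betw_def)
qed

lemma Units_DirProd: "Units (M \<times>\<times> N) = Units M \<times> Units N"
proof -
  have "(a, b) \<in> Units (M \<times>\<times> N) \<longleftrightarrow> a \<in> Units M \<and> b \<in> Units N" for a b
    unfolding Units_def by (simp add: Bex_def) blast
  then show ?thesis by auto
qed

lemma units_of_DirProd: "units_of (M \<times>\<times> N) = units_of M \<times>\<times> units_of N"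
  by (simp add: units_of_def Units_DirProd) (simp add: DirProd_def)

text \<open>A homomorphism out of a group carries inverses to inverses, so its image consists of
  units and only surjectivity onto them is left to check. The identity is a separate condition
  because a homomorphism into a monoid need not preserve it.\<close>

lemma units_of_iso_surj_units:
  assumes "group A" and M: "monoid M" and h: "h \<in> hom A M" "inj_on h (carrier A)" "h \<one>\<^bsub>A\<^esub> = \<one>\<^bsub>M\<^esub>"
    and surj: "\<And>y. y \<in> Units M \<Longrightarrow> y \<in> h ` carrier A"
  shows "A \<cong> units_of M"
proof -
  interpret A: group A by fact
  have "h x \<in> Units M" if "x \<in> carrier A" for x
  proof -
    have "h x \<otimes>\<^bsub>M\<^esub> h (inv\<^bsub>A\<^esub> x) = \<one>\<^bsub>M\<^esub>" "h (inv\<^bsub>A\<^esub> x) \<otimes>\<^bsub>M\<^esub> h x = \<one>\<^bsub>M\<^esub>"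
      using that h by (simp_all add: hom_mult[OF h(1), symmetric])
    then show ?thesis
      using that hom_in_carrier[OF h(1)] by (auto simp: Units_def)
  qed
  then have "h ` carrier A = Units M"
    using surj by auto
  then have "h \<in> iso A (units_of M)"
    using h by (auto simp: iso_def bij_betw_def hom_def units_of_def)
  then show ?thesis by (rule is_isoI)
qed

text \<open>Units are transported through the equations xy = 1 and yx = 1, so only \<open>M\<close>
  is assumed to be a monoid. With \<open>N\<close> a group algebra, the ring laws are then checked
  on the explicit side alone.\<close>

lemma units_of_cong:
  assumes M: "monoid M" and h: "h \<in> iso M N" "h \<one>\<^bsub>M\<^esub> = \<one>\<^bsub>N\<^esub>"
  shows "units_of M \<cong> units_of N"
proof -
  interpret M: monoid M by fact
  have hom: "h \<in> hom M N" and bij: "h ` carrier M = carrier N" "inj_on h (carrier M)"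
    using h(1) by (auto simp: iso_def bij_betw_def)
  have unit: "h x \<in> Units N \<longleftrightarrow> x \<in> Units M" if x: "x \<in> carrier M" for x
  proof -
    have "h x \<otimes>\<^bsub>N\<^esub> h y = \<one>\<^bsub>N\<^esub> \<longleftrightarrow> x \<otimes>\<^bsub>M\<^esub> y = \<one>\<^bsub>M\<^esub>" "h y \<otimes>\<^bsub>N\<^esub> h x = \<one>\<^bsub>N\<^esub> \<longleftrightarrow> y \<otimes>\<^bsub>M\<^esub> x = \<one>\<^bsub>M\<^esub>"
      if "y \<in> carrier M" for y
      using x that
      by (simp_all add: hom_mult[OF hom, symmetric] h(2)[symmetric] inj_on_eq_iff[OF bij(2)])
    then show ?thesis
      using x unfolding Units_def bij(1)[symmetric] by (simp add: inj_on_image_mem_iff[OF bij(2)])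
  qed
  have "h ` Units M = Units N"
  proof
    show "h ` Units M \<subseteq> Units N" using unit by auto
    show "Units N \<subseteq> h ` Units M"
    proof
      fix y assume y: "y \<in> Units N"
      then have "y \<in> h ` carrier M" using bij(1) by (auto simp: Units_def)
      then show "y \<in> h ` Units M" using unit y by auto
    qed
  qed
  moreover have "inj_on h (Units M)"
    using bij(2) M.Units_closed by (auto simp: inj_on_def)
  moreover have "h \<in> hom (units_of M) (units_of N)"
    using unit hom_mult[OF hom] M.Units_closed by (intro homI) (auto simp: units_of_def)
  ultimately show ?thesis
    by (intro is_isoI isoI) (auto simp: bij_betw_def units_of_def)
qed

lemma units_of_congI:
  assumes M: "monoid M"
    and h: "\<And>x. x \<in> carrier M \<Longrightarrow> h x \<in> carrier N"
      "\<And>x y. \<lbrakk>x \<in> carrier M; y \<in> carrier M\<rbrakk> \<Longrightarrow> h (x \<otimes>\<^bsub>M\<^esub> y) = h x \<otimes>\<^bsub>N\<^esub> h y"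
      "h \<one>\<^bsub>M\<^esub> = \<one>\<^bsub>N\<^esub>"
    and g: "\<And>y. y \<in> carrier N \<Longrightarrow> g y \<in> carrier M"
      "\<And>x. x \<in> carrier M \<Longrightarrow> g (h x) = x"
      "\<And>y. y \<in> carrier N \<Longrightarrow> h (g y) = y"
  shows "units_of M \<cong> units_of N"
proof (rule units_of_cong[OF M])
  have "bij_betw h (carrier M) (carrier N)"
    by (rule bij_betw_byWitness[where f' = g])
      (intro ballI image_subsetI g h, assumption)+
  then show "h \<in> iso M N"
    using h by (intro isoI homI)
  show "h \<one>\<^bsub>M\<^esub> = \<one>\<^bsub>N\<^esub>" by fact
qed

lemma DirProd_cong: "\<lbrakk>A \<cong> A'; B \<cong> B'\<rbrakk> \<Longrightarrow> A \<times>\<times> B \<cong> A' \<times>\<times> B'"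
proof -
  assume "A \<cong> A'" "B \<cong> B'"
  then obtain f g where f: "f \<in> iso A A'" and g: "g \<in> iso B B'"
    by (auto simp: is_iso_def)
  then have "(\<lambda>(a, b). (f a, g b)) \<in> hom (A \<times>\<times> B) (A' \<times>\<times> B')"
    by (auto simp: iso_def hom_def)
  moreover have "bij_betw (\<lambda>(a, b). (f a, g b)) (carrier (A \<times>\<times> B)) (carrier (A' \<times>\<times> B'))"
    using f g bij_betw_map_prod[of f "carrier A" "carrier A'" g "carrier B" "carrier B'"]
    by (simp add: iso_def map_prod_def)
  ultimately show ?thesis
    by (intro is_isoI isoI)
qed

lemma DirProd_swap4:
  "(A \<times>\<times> B) \<times>\<times> (C \<times>\<times> D) \<cong> (A \<times>\<times> C) \<times>\<times> (B \<times>\<times> D)"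
proof (rule is_isoI, rule isoI)
  show "(\<lambda>((a, b), (c, d)). ((a, c), (b, d))) \<in>
     hom ((A \<times>\<times> B) \<times>\<times> (C \<times>\<times> D)) ((A \<times>\<times> C) \<times>\<times> (B \<times>\<times> D))"
    by (auto simp: hom_def)
  show "bij_betw (\<lambda>((a, b), (c, d)). ((a, c), (b, d)))
     (carrier ((A \<times>\<times> B) \<times>\<times> (C \<times>\<times> D))) (carrier ((A \<times>\<times> C) \<times>\<times> (B \<times>\<times> D)))"
    by (rule bij_betw_byWitness[where f' = "\<lambda>((a, c), (b, d)). ((a, b), (c, d))"]) auto
qed

lemma DirProd_assoc: "(A \<times>\<times> B) \<times>\<times> C \<cong> A \<times>\<times> B \<times>\<times> C"
proof (rule is_isoI, rule isoI)
  show "(\<lambda>((a, b), c). (a, b, c)) \<in> hom ((A \<times>\<times> B) \<times>\<times> C) (A \<times>\<times> B \<times>\<times> C)"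
    by (auto simp: hom_def)
  show "bij_betw (\<lambda>((a, b), c). (a, b, c))
     (carrier ((A \<times>\<times> B) \<times>\<times> C)) (carrier (A \<times>\<times> B \<times>\<times> C))"
    by (rule bij_betw_byWitness[where f' = "\<lambda>(a, b, c). ((a, b), c)"]) auto
qed

section \<open>The groups C_n^m: order and splitting of the exponent\<close>

lemma group_cyclic_power: "group (cyclic_power n m)"
  by (simp add: cyclic_power_def)

lemma card_cyclic_power:
  assumes "n > 0"
  shows "finite (carrier (cyclic_power n m))" "card (carrier (cyclic_power n m)) = n ^ m"
  using assms
  by (auto simp: cyclic_power_def carrier_integer_mod_group card_PiE intro!: finite_PiE)

lemma cyclic_power_1: "cyclic_power n 1 \<cong> integer_mod_group n"
proof -
  have "(\<lambda>v. v 0) \<in> iso (cyclic_power n 1) (integer_mod_group n)"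
  proof (rule isoI)
    show "(\<lambda>v. v 0) \<in> hom (cyclic_power n 1) (integer_mod_group n)"
      by (auto simp: hom_def cyclic_power_def)
    show "bij_betw (\<lambda>v. v 0) (carrier (cyclic_power n 1)) (carrier (integer_mod_group n))"
      by (rule bij_betw_byWitness[where f' = "\<lambda>x. \<lambda>i\<in>{..<1}. x"])
        (auto simp: cyclic_power_def PiE_def extensional_def fun_eq_iff)
  qed
  then show ?thesis by (rule is_isoI)
qed

lemma cyclic_power_add: "cyclic_power n (a + b) \<cong> cyclic_power n a \<times>\<times> cyclic_power n b"
proof -
  define f :: "(nat \<Rightarrow> int) \<Rightarrow> _"
    where "f v = (restrict v {..<a}, \<lambda>i\<in>{..<b}. v (a + i))" for v
  define g :: "(nat \<Rightarrow> int) \<times> (nat \<Rightarrow> int) \<Rightarrow> _"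
    where "g z = (\<lambda>i\<in>{..<a + b}. if i < a then fst z i else snd z (i - a))" for z
  define Z where "Z = carrier (integer_mod_group n)"
  have carrier: "carrier (cyclic_power n m) = {..<m} \<rightarrow>\<^sub>E Z" for m
    by (simp add: cyclic_power_def Z_def)
  have f_in: "f v \<in> ({..<a} \<rightarrow>\<^sub>E Z) \<times> ({..<b} \<rightarrow>\<^sub>E Z)" if "v \<in> {..<a + b} \<rightarrow>\<^sub>E Z" for v
    using PiE_mem[OF that] by (simp add: f_def)
  have g_in: "g z \<in> {..<a + b} \<rightarrow>\<^sub>E Z" if z: "z \<in> ({..<a} \<rightarrow>\<^sub>E Z) \<times> ({..<b} \<rightarrow>\<^sub>E Z)" for z
  proof -
    have "fst z i \<in> Z" if "i < a" for i
      using z that PiE_mem[of "fst z" "{..<a}" "\<lambda>_. Z" i] by auto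
    moreover have "snd z i \<in> Z" if "i < b" for i
      using z that PiE_mem[of "snd z" "{..<b}" "\<lambda>_. Z" i] by auto
    ultimately show ?thesis by (simp add: g_def)
  qed
  have gf: "g (f v) = v" if "v \<in> {..<a + b} \<rightarrow>\<^sub>E Z" for v
  proof
    show "g (f v) i = v i" for i
      \<comment> \<open>Beyond the index set both sides equal \<open>undefined\<close>;
        \<open>PiE_arb\<close> supplies this for \<open>v\<close>.\<close>
      using PiE_arb[OF that, of i] by (simp add: f_def g_def)
  qed
  have fg: "f (g z) = z" if "z \<in> ({..<a} \<rightarrow>\<^sub>E Z) \<times> ({..<b} \<rightarrow>\<^sub>E Z)" for z
  proof (rule prod_eqI; rule ext)
    show "fst (f (g z)) i = fst z i" for i
      using that PiE_arb[of "fst z" "{..<a}" "\<lambda>_. Z" i] by (auto simp: f_def g_def)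
    show "snd (f (g z)) i = snd z i" for i
      using that PiE_arb[of "snd z" "{..<b}" "\<lambda>_. Z" i] by (auto simp: f_def g_def)
  qed
  have bij: "bij_betw f ({..<a + b} \<rightarrow>\<^sub>E Z) (({..<a} \<rightarrow>\<^sub>E Z) \<times> ({..<b} \<rightarrow>\<^sub>E Z))"
    by (rule bij_betw_byWitness[where f' = g])
      (intro ballI image_subsetI gf fg f_in g_in, assumption)+
  have "f (v \<otimes>\<^bsub>cyclic_power n (a + b)\<^esub> w) =
      f v \<otimes>\<^bsub>cyclic_power n a \<times>\<times> cyclic_power n b\<^esub> f w" for v w
  proof -
    have 1: "restrict (v \<otimes>\<^bsub>cyclic_power n (a + b)\<^esub> w) {..<a} =
        restrict v {..<a} \<otimes>\<^bsub>cyclic_power n a\<^esub> restrict w {..<a}"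
      by (rule ext) (simp add: cyclic_power_def)
    have 2: "(\<lambda>i\<in>{..<b}. (v \<otimes>\<^bsub>cyclic_power n (a + b)\<^esub> w) (a + i)) =
        (\<lambda>i\<in>{..<b}. v (a + i)) \<otimes>\<^bsub>cyclic_power n b\<^esub> (\<lambda>i\<in>{..<b}. w (a + i))"
      by (rule ext) (simp add: cyclic_power_def)
    show ?thesis unfolding f_def mult_DirProd 1 2 ..
  qed
  then have "f \<in> hom (cyclic_power n (a + b)) (cyclic_power n a \<times>\<times> cyclic_power n b)"
    using f_in by (intro homI) (simp_all add: carrier)
  then show ?thesis
    using bij by (intro is_isoI isoI) (simp_all add: carrier)
qed

section \<open>Elementary abelian and cyclic groups\<close>

text \<open>Addition in \<open>integer_mod_group n\<close> drops a multiple of \<open>n\<close>,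
  which is harmless in the exponent because the \<open>n\<close>-th power of \<open>x\<close> is the
  identity.\<close>

lemma (in group) hom_integer_mod_group:
  assumes x: "x \<in> carrier G" "x [^] n = \<one>"
  shows "(\<lambda>i. x [^] (i::int)) \<in> hom (integer_mod_group n) G"
proof (rule homI)
  fix i j :: int
  define r d where "r = (i + j) mod int n" and "d = (i + j) div int n"
  have "x [^] (int n * d) = (x [^] int n) [^] d"
    using x(1) by (rule int_pow_pow[symmetric])
  also have "\<dots> = \<one>"
    using x(2) by (simp add: int_pow_int)
  finally have "x [^] (r + int n * d) = x [^] r"
    using x(1) by (simp add: int_pow_mult)
  then have "x [^] r = x [^] (i + j)"
    by (simp add: r_def d_def)
  then show "x [^] (i \<otimes>\<^bsub>integer_mod_group n\<^esub> j) = x [^] i \<otimes> x [^] j"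
    using x(1) by (simp add: int_pow_mult r_def)
qed (use x in simp)

text \<open>Extending a linearly independent family over the field with \<open>p\<close> elements,
  phrased without vector spaces: while p^m < p^n some \<open>x\<close> lies outside the image, and
  adjoining its powers embeds one more factor.\<close>

lemma (in comm_group) elementary_abelian_mon:
  assumes p: "prime p" and exponent: "\<And>x. x \<in> carrier G \<Longrightarrow> x [^] p = \<one>"
    and order: "card (carrier G) = p ^ n" and "m \<le> n"
  shows "\<exists>f. f \<in> mon (cyclic_power p m) G"
  using \<open>m \<le> n\<close>
proof (induction m)
  case 0
  have "(\<lambda>_. \<one>) \<in> mon (cyclic_power p 0) G"
    by (auto simp: mon_def hom_def inj_on_def cyclic_power_def)
  then show ?case by blast
next
  case (Suc m)
  have p0: "p > 0" using p prime_gt_0_nat by blast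
  obtain f where f: "f \<in> hom (cyclic_power p m) G" "inj_on f (carrier (cyclic_power p m))"
    using Suc by (auto simp: mon_def)
  interpret f: group_hom "cyclic_power p m" G f
    using f(1) group_cyclic_power by (intro group_hom.intro group_hom_axioms.intro is_group)
  have fin: "finite (carrier G)"
    using order p0 by (intro card_ge_0_finite) simp
  have "card (f ` carrier (cyclic_power p m)) = p ^ m"
    using f(2) by (simp add: card_image card_cyclic_power p0)
  also have "\<dots> < card (carrier G)"
    using Suc.prems prime_gt_1_nat[OF p] by (simp add: order Suc_le_eq)
  finally have "f ` carrier (cyclic_power p m) \<noteq> carrier G"
    by auto
  moreover have "f ` carrier (cyclic_power p m) \<subseteq> carrier G"
    by (rule subgroup.subset[OF f.img_is_subgroup])
  ultimately obtain x where x: "x \<in> carrier G" "x \<notin> f ` carrier (cyclic_power p m)"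
    by auto
  have pow: "(\<lambda>i. x [^] (i::int)) \<in> hom (integer_mod_group p) G"
    using x(1) exponent by (intro hom_integer_mod_group) auto
  let ?H = "cyclic_power p m \<times>\<times> integer_mod_group p"
  let ?g = "\<lambda>(v, i). f v \<otimes> x [^] (i::int)"
  have g: "?g \<in> hom ?H G"
  proof (rule homI)
    fix s t assume "s \<in> carrier ?H" "t \<in> carrier ?H"
    then obtain u i v j where st: "s = (u, i)" "t = (v, j)"
      and [simp]: "u \<in> carrier (cyclic_power p m)" "v \<in> carrier (cyclic_power p m)"
      and ij: "i \<in> carrier (integer_mod_group p)" "j \<in> carrier (integer_mod_group p)"
      by auto
    show "?g (s \<otimes>\<^bsub>?H\<^esub> t) = ?g s \<otimes> ?g t"
      using x(1) hom_mult[OF pow ij] by (simp add: st m_ac del: mult_integer_mod_group)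
  qed (use x(1) in auto)
  interpret g: group_hom ?H G ?g
    using g group_cyclic_power
    by (intro group_hom.intro group_hom_axioms.intro is_group DirProd_group) auto
  have "v = \<one>\<^bsub>cyclic_power p m\<^esub> \<and> i = 0"
    if v: "v \<in> carrier (cyclic_power p m)" and i: "0 \<le> i" "i < int p" and eq: "f v \<otimes> x [^] i = \<one>" for v i
  proof (cases "i = 0")
    case True
    then show ?thesis
      using eq v f(2)[unfolded f.inj_on_one_iff] x(1) by simp
  next
    case False
    then have "\<not> int p dvd i"
      using i zdvd_not_zless[of i "int p"] by simp
    then have "coprime i (int p)"
      using p prime_imp_coprime[of "int p" i] by (simp add: coprime_commute)
    \<comment> \<open>A nonzero \<open>i\<close> below \<open>p\<close> is invertible modulo
      \<open>p\<close>. Since x^i lies in the image of \<open>f\<close>, so does its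
      \<open>j\<close>-th power, which is \<open>x\<close> because x^p = 1; this contradicts the
      choice of \<open>x\<close>.\<close>
    then obtain j where j: "[i * j = 1] (mod int p)"
      using cong_solve_coprime_int by blast
    then obtain k where k: "i * j = 1 + int p * k"
      using cong_sym[OF j] by (auto simp: cong_iff_lin)
    have "x [^] i = f (inv\<^bsub>cyclic_power p m\<^esub> v)"
      using eq v x(1) inv_equality[of "x [^] i" "f v"] by (simp add: m_comm)
    then have "x [^] (i * j) = f ((inv\<^bsub>cyclic_power p m\<^esub> v) [^]\<^bsub>cyclic_power p m\<^esub> j)"
      using v x(1) by (simp add: int_pow_pow[symmetric] f.hom_int_pow)
    moreover have "x [^] (i * j) = x"
    proof -
      have "x [^] (i * j) = x [^] (1::int) \<otimes> (x [^] int p) [^] k"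
        using x(1) unfolding k by (simp only: int_pow_mult int_pow_pow)
      then show ?thesis using x(1) exponent by (simp add: int_pow_int)
    qed
    ultimately show ?thesis
      using v x(2) by auto
  qed
  then have "inj_on ?g (carrier ?H)"
    using p0 unfolding g.inj_on_one_iff by (auto simp: carrier_integer_mod_group)
  moreover obtain h where "h \<in> iso (cyclic_power p (Suc m)) ?H"
    using iso_trans[OF cyclic_power_add[of p m 1] DirProd_cong[OF iso_refl cyclic_power_1[of p]]]
    unfolding is_iso_def by auto
  ultimately have "?g \<circ> h \<in> mon (cyclic_power p (Suc m)) G"
    using Group.hom_compose[of h "cyclic_power p (Suc m)" ?H ?g G] g
    by (auto simp: mon_def iso_def bij_betw_def intro!: comp_inj_on)
  then show ?case by blast
qed

text \<open>At \<open>m = n\<close> the embedding joins groups of equal finite order.\<close>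

theorem (in comm_group) elementary_abelian_iso:
  assumes p: "prime p" and exponent: "\<And>x. x \<in> carrier G \<Longrightarrow> x [^] p = \<one>"
    and order: "card (carrier G) = p ^ n"
  shows "G \<cong> cyclic_power p n"
proof -
  obtain f where f: "f \<in> mon (cyclic_power p n) G"
    using elementary_abelian_mon[OF assms order_refl] by blast
  have p0: "p > 0" using p prime_gt_0_nat by blast
  then have "finite (carrier G)"
    using order by (intro card_ge_0_finite) simp
  then have "cyclic_power p n \<cong> G"
    using f order p0 by (intro is_isoI_inj_card[of f]) (auto simp: mon_def card_cyclic_power)
  then show ?thesis by (rule group.iso_sym[OF group_cyclic_power])
qed

text \<open>A generator of the multiplicative group gives a surjection from the integers modulo
  \<open>n\<close>; equality of the orders makes it injective.\<close>

lemma (in field) units_of_iso_cyclic: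
  assumes fin: "finite (carrier R)"
  shows "units_of R \<cong> integer_mod_group (card (carrier R) - 1)"
proof -
  define n where "n = card (carrier R) - 1"
  interpret M: group "mult_of R" by (rule field_mult_group)
  have fin': "finite (carrier (mult_of R))" using fin by (rule finite_mult_of)
  have order: "order (mult_of R) = n" using fin by (simp add: order_mult_of order_def n_def)
  \<comment> \<open>\<open>integer_mod_group 0\<close> is the infinite cyclic group, so the count of
    the source depends on \<open>n\<close> being positive.\<close>
  have n0: "n > 0" using M.order_gt_0_iff_finite order fin' by simp
  obtain a where a: "a \<in> carrier (mult_of R)"
    "carrier (mult_of R) = {a [^]\<^bsub>mult_of R\<^esub> i | i::nat. i \<in> UNIV}"
    using finite_field_mult_group_has_gen[OF fin] by (auto simp: nat_pow_mult_of)
  have pow: "a [^]\<^bsub>mult_of R\<^esub> n = \<one>\<^bsub>mult_of R\<^esub>"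
    using M.pow_order_eq_1[OF a(1)] order by simp
  let ?f = "\<lambda>i::int. a [^]\<^bsub>mult_of R\<^esub> i"
  have hom: "?f \<in> hom (integer_mod_group n) (mult_of R)"
    by (rule M.hom_integer_mod_group[OF a(1) pow])
  have surj: "carrier (mult_of R) \<subseteq> ?f ` carrier (integer_mod_group n)"
  proof
    fix y assume "y \<in> carrier (mult_of R)"
    then obtain i :: nat where y: "y = a [^]\<^bsub>mult_of R\<^esub> i" using a(2) by blast
    \<comment> \<open>The generator comes with arbitrary natural exponents; division with remainder
      brings the exponent into the carrier.\<close>
    have "y = (a [^]\<^bsub>mult_of R\<^esub> n) [^]\<^bsub>mult_of R\<^esub> (i div n) \<otimes>\<^bsub>mult_of R\<^esub> a [^]\<^bsub>mult_of R\<^esub> (i mod n)"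
      using a(1) by (simp only: y M.nat_pow_pow M.nat_pow_mult) (simp add: mult.commute)
    then have "y = ?f (int (i mod n))"
      using a(1) unfolding pow int_pow_int by (simp only: M.nat_pow_one M.l_one M.nat_pow_closed)
    then show "y \<in> ?f ` carrier (integer_mod_group n)"
      using n0 by (intro image_eqI) (auto simp: carrier_integer_mod_group)
  qed
  then have "?f ` carrier (integer_mod_group n) = carrier (mult_of R)"
    using hom by (auto simp: hom_def)
  moreover have "card (carrier (integer_mod_group n)) = card (carrier (mult_of R))"
    using n0 order by (simp add: carrier_integer_mod_group order_def)
  ultimately have "inj_on ?f (carrier (integer_mod_group n))"
    using n0 by (intro eq_card_imp_inj_on) (auto simp: carrier_integer_mod_group)
  then have "integer_mod_group n \<cong> mult_of R"
    using hom n0 order fin'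
    by (intro is_isoI_inj_card[of ?f]) (auto simp: carrier_integer_mod_group order_def)
  then show ?thesis
    unfolding n_def mult_of_is_Units by (rule group.iso_sym[OF group_integer_mod_group])
qed

section \<open>Polynomial identities in commutative rings\<close>

primrec vars_below :: "nat \<Rightarrow> polex \<Rightarrow> bool" where
  "vars_below k (Var n) \<longleftrightarrow> n < k"
| "vars_below k (Const i) \<longleftrightarrow> True"
| "vars_below k (Add P Q) \<longleftrightarrow> vars_below k P \<and> vars_below k Q"
| "vars_below k (Sub P Q) \<longleftrightarrow> vars_below k P \<and> vars_below k Q"
| "vars_below k (Mul P Q) \<longleftrightarrow> vars_below k P \<and> vars_below k Q"
| "vars_below k (Pow P n) \<longleftrightarrow> vars_below k P"
| "vars_below k (Neg P) \<longleftrightarrow> vars_below k P"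

text \<open>A variant of \<open>cring.Ipolex\<close> of the shape \<open>reify\<close> accepts: the expression is the first argument
  and variables are looked up by \<open>nth\<close>. The two agree only for indices within the environment.\<close>

primrec peval :: "polex \<Rightarrow> ('a, 'm) ring_scheme \<Rightarrow> 'a list \<Rightarrow> 'a" where
  "peval (Var n) R xs = xs ! n"
| "peval (Const i) R xs = \<guillemotleft>i\<guillemotright>\<^bsub>R\<^esub>"
| "peval (Add P Q) R xs = peval P R xs \<oplus>\<^bsub>R\<^esub> peval Q R xs"
| "peval (Sub P Q) R xs = peval P R xs \<ominus>\<^bsub>R\<^esub> peval Q R xs"
| "peval (Mul P Q) R xs = peval P R xs \<otimes>\<^bsub>R\<^esub> peval Q R xs"
| "peval (Pow P n) R xs = peval P R xs [^]\<^bsub>R\<^esub> n"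
| "peval (Neg P) R xs = \<ominus>\<^bsub>R\<^esub> peval P R xs"

text \<open>An equation is reified as one object so that both sides share a single
  environment.\<close>

primrec peq :: "polex \<times> polex \<Rightarrow> ('a, 'm) ring_scheme \<Rightarrow> 'a list \<Rightarrow> bool" where
  "peq (P, Q) R xs \<longleftrightarrow> peval P R xs = peval Q R xs"

context cring
begin

text \<open>Only \<open>\<zero>\<close> and \<open>\<one>\<close> occur as constants, and
  \<open>Pow\<close> has no clause: in every reified identity squares and cubes are written as
  products.\<close>

lemma ring_reify:
  "peval (Var n) R xs = xs ! n"
  "peval (Const 0) R xs = \<zero>"
  "peval (Const 1) R xs = \<one>"
  "peval (Add P Q) R xs = peval P R xs \<oplus> peval Q R xs"
  "peval (Sub P Q) R xs = peval P R xs \<ominus> peval Q R xs"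
  "peval (Mul P Q) R xs = peval P R xs \<otimes> peval Q R xs"
  "peval (Neg P) R xs = \<ominus> peval P R xs"
  "peq (P, Q) R xs \<longleftrightarrow> peval P R xs = peval Q R xs"
  by simp_all

lemma peval_Ipolex: "vars_below (length xs) P \<Longrightarrow> peval P R xs = Ipolex xs P"
proof (induction P)
  case (Var n)
  then have "drop n xs = xs ! n # drop (Suc n) xs"
    by (simp add: Cons_nth_drop_Suc)
  then show ?case by simp
qed simp_all

text \<open>In the recurring proof pattern, three calls of \<open>simp\<close> discharge the
  conditions on the environment and \<open>code_simp\<close> evaluates the two normal forms.
  Identities proved this way hold in every commutative ring.\<close>

lemma peqI:
  assumes "set xs \<subseteq> carrier R" "vars_below (length xs) P" "vars_below (length xs) Q"
    "norm P = norm Q"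
  shows "peq (P, Q) R xs"
  using assms norm_eq[of xs P Q] by (auto simp: peval_Ipolex in_carrier_def)

text \<open>A certificate of ideal membership: the first premise is a bare polynomial identity,
  \<open>t = \<zero>\<close> is the relation available in the ring, and \<open>w\<close> is the
  cofactor. This is why inverses are later given by relations with right side
  \<open>\<zero>\<close>, such as \<open>t \<otimes> (\<one> \<oplus> \<one>) \<ominus> \<one> =
  \<zero>\<close>.\<close>

lemma eq_by_multiple:
  assumes "x \<ominus> y \<ominus> t \<otimes> w = \<zero>" "t = \<zero>" "w \<in> carrier R" "x \<in> carrier R" "y \<in> carrier R"
  shows "x = y"
proof -
  have "t \<otimes> w = \<zero>" using assms(2,3) by simp
  moreover have "x \<ominus> y \<ominus> \<zero> = x \<ominus> y"
    using assms(4,5) unfolding a_minus_def by (simp only: minus_zero r_zero a_closed a_inv_closed)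
  ultimately have "x \<ominus> y = \<zero>" using assms(1) by simp
  then show ?thesis using assms(4,5) r_right_minus_eq by blast
qed

end

section \<open>The rings $R[C_2]$, $R[C_3]$ and $R[\<omega>]$\<close>

text \<open>\<open>quad_ext R u v\<close> is $R[X]/(X^2 - uX - v)$, with \<open>(a, b)\<close> standing for $a + bX$.\<close>

definition quad_ext :: "('a, 'm) ring_scheme \<Rightarrow> 'a \<Rightarrow> 'a \<Rightarrow> ('a \<times> 'a) ring" where
  "quad_ext R u v =
     \<lparr>carrier = carrier R \<times> carrier R,
      monoid.mult = (\<lambda>(a, b) (c, d). (a \<otimes>\<^bsub>R\<^esub> c \<oplus>\<^bsub>R\<^esub> v \<otimes>\<^bsub>R\<^esub> (b \<otimes>\<^bsub>R\<^esub> d),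
                a \<otimes>\<^bsub>R\<^esub> d \<oplus>\<^bsub>R\<^esub> b \<otimes>\<^bsub>R\<^esub> c \<oplus>\<^bsub>R\<^esub> u \<otimes>\<^bsub>R\<^esub> (b \<otimes>\<^bsub>R\<^esub> d))),
      one = (\<one>\<^bsub>R\<^esub>, \<zero>\<^bsub>R\<^esub>),
      zero = (\<zero>\<^bsub>R\<^esub>, \<zero>\<^bsub>R\<^esub>),
      add = (\<lambda>(a, b) (c, d). (a \<oplus>\<^bsub>R\<^esub> c, b \<oplus>\<^bsub>R\<^esub> d))\<rparr>"

lemma quad_ext_simps [simp]:
  "carrier (quad_ext R u v) = carrier R \<times> carrier R"
  "(a, b) \<otimes>\<^bsub>quad_ext R u v\<^esub> (c, d) =
    (a \<otimes>\<^bsub>R\<^esub> c \<oplus>\<^bsub>R\<^esub> v \<otimes>\<^bsub>R\<^esub> (b \<otimes>\<^bsub>R\<^esub> d), a \<otimes>\<^bsub>R\<^esub> d \<oplus>\<^bsub>R\<^esub> b \<otimes>\<^bsub>R\<^esub> c \<oplus>\<^bsub>R\<^esub> u \<otimes>\<^bsub>R\<^esub> (b \<otimes>\<^bsub>R\<^esub> d))"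
  "\<one>\<^bsub>quad_ext R u v\<^esub> = (\<one>\<^bsub>R\<^esub>, \<zero>\<^bsub>R\<^esub>)"
  "\<zero>\<^bsub>quad_ext R u v\<^esub> = (\<zero>\<^bsub>R\<^esub>, \<zero>\<^bsub>R\<^esub>)"
  "(a, b) \<oplus>\<^bsub>quad_ext R u v\<^esub> (c, d) = (a \<oplus>\<^bsub>R\<^esub> c, b \<oplus>\<^bsub>R\<^esub> d)"
  by (simp_all add: quad_ext_def)

text \<open>The parameters encode X^2 = 1, with X the generator of C_2. The other instance in use,
  \<open>quad_ext R (\<ominus> \<one>) (\<ominus> \<one>)\<close>, encodes X^2 + X + 1 = 0, so that
  X is a formal \<omega>.\<close>

abbreviation c2_ext :: "('a, 'm) ring_scheme \<Rightarrow> ('a \<times> 'a) ring" where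
  "c2_ext S \<equiv> quad_ext S \<zero>\<^bsub>S\<^esub> \<one>\<^bsub>S\<^esub>"

text \<open>\<open>cyc3_ext R\<close> is $R[X]/(X^3 - 1)$, with \<open>(a, b, c)\<close> standing for $a + bX + cX^2$.\<close>

definition cyc3_ext :: "('a, 'm) ring_scheme \<Rightarrow> ('a \<times> 'a \<times> 'a) ring" where
  "cyc3_ext R =
     \<lparr>carrier = carrier R \<times> carrier R \<times> carrier R,
      monoid.mult = (\<lambda>(a, b, c) (d, e, f).
        (a \<otimes>\<^bsub>R\<^esub> d \<oplus>\<^bsub>R\<^esub> b \<otimes>\<^bsub>R\<^esub> f \<oplus>\<^bsub>R\<^esub> c \<otimes>\<^bsub>R\<^esub> e,
         a \<otimes>\<^bsub>R\<^esub> e \<oplus>\<^bsub>R\<^esub> b \<otimes>\<^bsub>R\<^esub> d \<oplus>\<^bsub>R\<^esub> c \<otimes>\<^bsub>R\<^esub> f,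
         a \<otimes>\<^bsub>R\<^esub> f \<oplus>\<^bsub>R\<^esub> b \<otimes>\<^bsub>R\<^esub> e \<oplus>\<^bsub>R\<^esub> c \<otimes>\<^bsub>R\<^esub> d)),
      one = (\<one>\<^bsub>R\<^esub>, \<zero>\<^bsub>R\<^esub>, \<zero>\<^bsub>R\<^esub>),
      zero = (\<zero>\<^bsub>R\<^esub>, \<zero>\<^bsub>R\<^esub>, \<zero>\<^bsub>R\<^esub>),
      add = (\<lambda>(a, b, c) (d, e, f). (a \<oplus>\<^bsub>R\<^esub> d, b \<oplus>\<^bsub>R\<^esub> e, c \<oplus>\<^bsub>R\<^esub> f))\<rparr>"

lemma cyc3_ext_simps [simp]:
  "carrier (cyc3_ext R) = carrier R \<times> carrier R \<times> carrier R"
  "(a, b, c) \<otimes>\<^bsub>cyc3_ext R\<^esub> (d, e, f) =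
     (a \<otimes>\<^bsub>R\<^esub> d \<oplus>\<^bsub>R\<^esub> b \<otimes>\<^bsub>R\<^esub> f \<oplus>\<^bsub>R\<^esub> c \<otimes>\<^bsub>R\<^esub> e,
      a \<otimes>\<^bsub>R\<^esub> e \<oplus>\<^bsub>R\<^esub> b \<otimes>\<^bsub>R\<^esub> d \<oplus>\<^bsub>R\<^esub> c \<otimes>\<^bsub>R\<^esub> f,
      a \<otimes>\<^bsub>R\<^esub> f \<oplus>\<^bsub>R\<^esub> b \<otimes>\<^bsub>R\<^esub> e \<oplus>\<^bsub>R\<^esub> c \<otimes>\<^bsub>R\<^esub> d)"
  "\<one>\<^bsub>cyc3_ext R\<^esub> = (\<one>\<^bsub>R\<^esub>, \<zero>\<^bsub>R\<^esub>, \<zero>\<^bsub>R\<^esub>)"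
  "\<zero>\<^bsub>cyc3_ext R\<^esub> = (\<zero>\<^bsub>R\<^esub>, \<zero>\<^bsub>R\<^esub>, \<zero>\<^bsub>R\<^esub>)"
  "(a, b, c) \<oplus>\<^bsub>cyc3_ext R\<^esub> (d, e, f) = (a \<oplus>\<^bsub>R\<^esub> d, b \<oplus>\<^bsub>R\<^esub> e, c \<oplus>\<^bsub>R\<^esub> f)"
  by (simp_all add: cyc3_ext_def)

context cring
begin

lemma quad_ext_cring:
  assumes [simp]: "u \<in> carrier R" "v \<in> carrier R"
  shows "cring (quad_ext R u v)"
proof (rule cringI)
  show "abelian_group (quad_ext R u v)"
  proof (rule abelian_groupI)
    fix x assume "x \<in> carrier (quad_ext R u v)"
    then obtain a b where "x = (a, b)" "a \<in> carrier R" "b \<in> carrier R" by auto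
    then show "\<exists>y\<in>carrier (quad_ext R u v). y \<oplus>\<^bsub>quad_ext R u v\<^esub> x = \<zero>\<^bsub>quad_ext R u v\<^esub>"
      by (intro bexI[of _ "(\<ominus> a, \<ominus> b)"]) (auto simp: l_neg)
  qed (auto simp: a_ac)
  show "comm_monoid (quad_ext R u v)"
  proof (rule comm_monoidI, goal_cases)
    \<comment> \<open>Cases 3 and 5 are associativity and commutativity; the other laws are
      immediate.\<close>
    case (3 x y z)
    then obtain a b c d e f where eq: "x = (a, b)" "y = (c, d)" "z = (e, f)"
      and [simp]: "a \<in> carrier R" "b \<in> carrier R" "c \<in> carrier R"
      "d \<in> carrier R" "e \<in> carrier R" "f \<in> carrier R"
      by auto
    show ?case unfolding eq quad_ext_simps prod.inject
      by (intro conjI; (reify ring_reify, rule peqI, simp, simp, simp, code_simp))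
  next
    case (5 x y)
    then obtain a b c d where eq: "x = (a, b)" "y = (c, d)"
      and [simp]: "a \<in> carrier R" "b \<in> carrier R" "c \<in> carrier R" "d \<in> carrier R"
      by auto
    show ?case unfolding eq quad_ext_simps prod.inject
      by (intro conjI; (reify ring_reify, rule peqI, simp, simp, simp, code_simp))
  qed auto
  fix x y z assume "x \<in> carrier (quad_ext R u v)" "y \<in> carrier (quad_ext R u v)"
    "z \<in> carrier (quad_ext R u v)"
  then obtain a b c d e f where eq: "x = (a, b)" "y = (c, d)" "z = (e, f)"
    and [simp]: "a \<in> carrier R" "b \<in> carrier R" "c \<in> carrier R"
    "d \<in> carrier R" "e \<in> carrier R" "f \<in> carrier R"
    by auto
  show "(x \<oplus>\<^bsub>quad_ext R u v\<^esub> y) \<otimes>\<^bsub>quad_ext R u v\<^esub> z =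
    x \<otimes>\<^bsub>quad_ext R u v\<^esub> z \<oplus>\<^bsub>quad_ext R u v\<^esub> y \<otimes>\<^bsub>quad_ext R u v\<^esub> z"
    unfolding eq quad_ext_simps prod.inject by (intro conjI; (reify ring_reify, rule peqI, simp, simp, simp, code_simp))
qed

lemma cyc3_ext_cring: "cring (cyc3_ext R)"
proof (rule cringI)
  show "abelian_group (cyc3_ext R)"
  proof (rule abelian_groupI)
    fix x assume "x \<in> carrier (cyc3_ext R)"
    then obtain a b c where "x = (a, b, c)" "a \<in> carrier R" "b \<in> carrier R" "c \<in> carrier R"
      by auto
    then show "\<exists>y\<in>carrier (cyc3_ext R). y \<oplus>\<^bsub>cyc3_ext R\<^esub> x = \<zero>\<^bsub>cyc3_ext R\<^esub>"
      by (intro bexI[of _ "(\<ominus> a, \<ominus> b, \<ominus> c)"]) (auto simp: l_neg)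
  qed (auto simp: a_ac)
  show "comm_monoid (cyc3_ext R)"
  proof (rule comm_monoidI, goal_cases)
    case (3 x y z)
    then obtain a b c d e f g h i where eq: "x = (a, b, c)" "y = (d, e, f)" "z = (g, h, i)"
      and [simp]: "a \<in> carrier R" "b \<in> carrier R" "c \<in> carrier R"
      "d \<in> carrier R" "e \<in> carrier R" "f \<in> carrier R"
      "g \<in> carrier R" "h \<in> carrier R" "i \<in> carrier R"
      by auto
    show ?case unfolding eq cyc3_ext_simps prod.inject
      by (intro conjI; (reify ring_reify, rule peqI, simp, simp, simp, code_simp))
  next
    case (5 x y)
    then obtain a b c d e f where eq: "x = (a, b, c)" "y = (d, e, f)"
      and [simp]: "a \<in> carrier R" "b \<in> carrier R" "c \<in> carrier R"
      "d \<in> carrier R" "e \<in> carrier R" "f \<in> carrier R"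
      by auto
    show ?case unfolding eq cyc3_ext_simps prod.inject
      by (intro conjI; (reify ring_reify, rule peqI, simp, simp, simp, code_simp))
  qed auto
  fix x y z assume "x \<in> carrier (cyc3_ext R)" "y \<in> carrier (cyc3_ext R)"
    "z \<in> carrier (cyc3_ext R)"
  then obtain a b c d e f g h i where eq: "x = (a, b, c)" "y = (d, e, f)" "z = (g, h, i)"
    and [simp]: "a \<in> carrier R" "b \<in> carrier R" "c \<in> carrier R"
    "d \<in> carrier R" "e \<in> carrier R" "f \<in> carrier R"
    "g \<in> carrier R" "h \<in> carrier R" "i \<in> carrier R"
    by auto
  show "(x \<oplus>\<^bsub>cyc3_ext R\<^esub> y) \<otimes>\<^bsub>cyc3_ext R\<^esub> z =
    x \<otimes>\<^bsub>cyc3_ext R\<^esub> z \<oplus>\<^bsub>cyc3_ext R\<^esub> y \<otimes>\<^bsub>cyc3_ext R\<^esub> z"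
    unfolding eq cyc3_ext_simps prod.inject by (intro conjI; (reify ring_reify, rule peqI, simp, simp, simp, code_simp))
qed

end

section \<open>Unit groups of the extensions\<close>

context cring
begin

lemma quad_ext_monoid: "\<lbrakk>u \<in> carrier R; v \<in> carrier R\<rbrakk> \<Longrightarrow> monoid (quad_ext R u v)"
  by (intro ring.is_monoid cring.axioms quad_ext_cring)

lemma cyc3_ext_monoid: "monoid (cyc3_ext R)"
  by (intro ring.is_monoid cring.axioms cyc3_ext_cring)

text \<open>\<open>t\<close> is the inverse of 2, and the inverse map takes half the sum and half
  the difference of the two values.\<close>

lemma units_of_quad_ext_split:
  assumes [simp]: "t \<in> carrier R" and t: "t \<otimes> (\<one> \<oplus> \<one>) \<ominus> \<one> = \<zero>"
  shows "units_of (c2_ext R) \<cong> units_of R \<times>\<times> units_of R"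
  unfolding units_of_DirProd[symmetric]
proof (rule units_of_congI[where h = "\<lambda>(a, b). (a \<oplus> b, a \<ominus> b)"
      and g = "\<lambda>(r, s). (t \<otimes> (r \<oplus> s), t \<otimes> (r \<ominus> s))"], goal_cases)
  \<comment> \<open>Cases 3, 6 and 7 are multiplicativity and the two inverse laws; the same
    numbering recurs in the next two lemmas.\<close>
  case (3 x y)
  then obtain a b c d where eq: "x = (a, b)" "y = (c, d)"
    and [simp]: "a \<in> carrier R" "b \<in> carrier R" "c \<in> carrier R" "d \<in> carrier R"
    by auto
  show ?case
    unfolding eq quad_ext_simps prod.case mult_DirProd prod.inject
    by (intro conjI; (reify ring_reify, rule peqI, simp, simp, simp, code_simp))
next
  case (6 x)
  then obtain a b where eq: "x = (a, b)" and [simp]: "a \<in> carrier R" "b \<in> carrier R"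
    by auto
  have "t \<otimes> ((a \<oplus> b) \<oplus> (a \<ominus> b)) = a"
    by (rule eq_by_multiple[OF _ t, of _ _ a],
        reify ring_reify, rule peqI, simp, simp, simp, code_simp, simp, simp, simp)
  moreover have "t \<otimes> ((a \<oplus> b) \<ominus> (a \<ominus> b)) = b"
    by (rule eq_by_multiple[OF _ t, of _ _ b],
        reify ring_reify, rule peqI, simp, simp, simp, code_simp, simp, simp, simp)
  ultimately show ?case by (simp add: eq)
next
  case (7 x)
  then obtain a b where eq: "x = (a, b)" and [simp]: "a \<in> carrier R" "b \<in> carrier R"
    by auto
  have "t \<otimes> (a \<oplus> b) \<oplus> t \<otimes> (a \<ominus> b) = a"
    by (rule eq_by_multiple[OF _ t, of _ _ a],
        reify ring_reify, rule peqI, simp, simp, simp, code_simp, simp, simp, simp)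
  moreover have "t \<otimes> (a \<oplus> b) \<ominus> t \<otimes> (a \<ominus> b) = b"
    by (rule eq_by_multiple[OF _ t, of _ _ b],
        reify ring_reify, rule peqI, simp, simp, simp, code_simp, simp, simp, simp)
  ultimately show ?case by (simp add: eq)
qed (auto simp: quad_ext_monoid a_minus_def)

text \<open>The components are evaluation at 1 and reduction modulo X^2 + X + 1, where X^2 = -1 - X
  turns a + bX + cX^2 into (a - c) + (b - c)X. Conversely s = a + b + c, u = a - c and v = b - c
  give s - u - v = 3c, and \<open>t\<close> is the inverse of 3.\<close>

lemma units_of_cyc3_ext_split:
  assumes [simp]: "t \<in> carrier R" and t: "t \<otimes> (\<one> \<oplus> \<one> \<oplus> \<one>) \<ominus> \<one> = \<zero>"
  shows "units_of (cyc3_ext R) \<cong> units_of R \<times>\<times> units_of (quad_ext R (\<ominus> \<one>) (\<ominus> \<one>))"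
  unfolding units_of_DirProd[symmetric]
proof (rule units_of_congI[where h = "\<lambda>(a, b, c). (a \<oplus> b \<oplus> c, (a \<ominus> c, b \<ominus> c))"
      and g = "\<lambda>(s, (u, v)). (u \<oplus> t \<otimes> (s \<ominus> u \<ominus> v), v \<oplus> t \<otimes> (s \<ominus> u \<ominus> v), t \<otimes> (s \<ominus> u \<ominus> v))"],
    goal_cases)
  case (3 x y)
  then obtain a b c d e f where eq: "x = (a, b, c)" "y = (d, e, f)"
    and [simp]: "a \<in> carrier R" "b \<in> carrier R" "c \<in> carrier R"
    "d \<in> carrier R" "e \<in> carrier R" "f \<in> carrier R"
    by auto
  show ?case
    unfolding eq quad_ext_simps cyc3_ext_simps prod.case mult_DirProd prod.inject
    by (intro conjI; (reify ring_reify, rule peqI, simp, simp, simp, code_simp))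
next
  case (6 x)
  then obtain a b c where eq: "x = (a, b, c)"
    and [simp]: "a \<in> carrier R" "b \<in> carrier R" "c \<in> carrier R"
    by auto
  define s where "s = t \<otimes> ((a \<oplus> b \<oplus> c) \<ominus> (a \<ominus> c) \<ominus> (b \<ominus> c))"
  have s: "s = c" unfolding s_def
    by (rule eq_by_multiple[OF _ t, of _ _ c],
        reify ring_reify, rule peqI, simp, simp, simp, code_simp, simp, simp, simp)
  have "(a \<ominus> c) \<oplus> c = a" "(b \<ominus> c) \<oplus> c = b"
    by (simp_all add: a_minus_def a_assoc l_neg)
  then show ?case by (simp add: eq s_def[symmetric] s)
next
  case (7 x)
  then obtain s u v where eq: "x = (s, u, v)"
    and [simp]: "s \<in> carrier R" "u \<in> carrier R" "v \<in> carrier R"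
    by auto
  define c where "c = t \<otimes> (s \<ominus> u \<ominus> v)"
  have [simp]: "c \<in> carrier R" by (simp add: c_def)
  have "u \<oplus> c \<oplus> (v \<oplus> c) \<oplus> c = s" unfolding c_def
    by (rule eq_by_multiple[OF _ t, of _ _ "s \<ominus> u \<ominus> v"],
        reify ring_reify, rule peqI, simp, simp, simp, code_simp, simp, simp, simp)
  moreover have "u \<oplus> c \<ominus> c = u" "v \<oplus> c \<ominus> c = v"
    by (simp_all add: a_minus_def a_assoc r_neg)
  ultimately show ?case by (simp add: eq c_def[symmetric])
qed (auto simp: cyc3_ext_monoid a_minus_def)

text \<open>Evaluation at the two roots \<omega> and -1 - \<omega>. Recovering \<open>b\<close>
  means dividing by the difference 2\<omega> + 1 of the roots, whose square is -3; this is where the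
  inverse \<open>t\<close> of 3 enters.\<close>

lemma units_of_quad_ext_omega:
  assumes [simp]: "\<omega> \<in> carrier R" "t \<in> carrier R"
    and \<omega>: "\<omega> \<otimes> \<omega> \<oplus> \<omega> \<oplus> \<one> = \<zero>" and t: "t \<otimes> (\<one> \<oplus> \<one> \<oplus> \<one>) \<ominus> \<one> = \<zero>"
  shows "units_of (quad_ext R (\<ominus> \<one>) (\<ominus> \<one>)) \<cong> units_of R \<times>\<times> units_of R"
proof -
  \<comment> \<open>The inverse of 2\<omega> + 1, read off from (2\<omega> + 1)^2 = -3 and 3t =
    1.\<close>
  define k where "k = \<ominus> (t \<otimes> (\<omega> \<oplus> \<omega> \<oplus> \<one>))"
  have [simp]: "k \<in> carrier R" by (simp add: k_def)
  have "k \<otimes> (\<omega> \<oplus> \<omega> \<oplus> \<one>) \<ominus> \<one> = t \<otimes> (\<one> \<oplus> \<one> \<oplus> \<one>) \<ominus> \<one>"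
    unfolding k_def
    by (rule eq_by_multiple[OF _ \<omega>, of _ _ "\<ominus> (t \<oplus> t \<oplus> t \<oplus> t)"],
        reify ring_reify, rule peqI, simp, simp, simp, code_simp, simp, simp, simp)
  then have k: "k \<otimes> (\<omega> \<oplus> \<omega> \<oplus> \<one>) \<ominus> \<one> = \<zero>" using t by simp
  show ?thesis
    unfolding units_of_DirProd[symmetric]
  proof (rule units_of_congI[where h = "\<lambda>(a, b). (a \<oplus> b \<otimes> \<omega>, a \<ominus> b \<ominus> b \<otimes> \<omega>)"
        and g = "\<lambda>(r, s). (r \<ominus> k \<otimes> (r \<ominus> s) \<otimes> \<omega>, k \<otimes> (r \<ominus> s))"], goal_cases)
    case (3 x y)
    then obtain a b c d where eq: "x = (a, b)" "y = (c, d)"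
      and [simp]: "a \<in> carrier R" "b \<in> carrier R" "c \<in> carrier R" "d \<in> carrier R"
      by auto
    show ?case
      unfolding eq quad_ext_simps prod.case mult_DirProd prod.inject
      \<comment> \<open>One cofactor serves both coordinates, since X^2 + X + 1 takes the same value
        at \<omega> and at -1 - \<omega>.\<close>
      by (intro conjI; (rule eq_by_multiple[OF _ \<omega>, of _ _ "\<ominus> (b \<otimes> d)"],
          reify ring_reify, rule peqI, simp, simp, simp, code_simp, simp, simp, simp))
  next
    case (6 x)
    then obtain a b where eq: "x = (a, b)" and [simp]: "a \<in> carrier R" "b \<in> carrier R"
      by auto
    define c where "c = k \<otimes> ((a \<oplus> b \<otimes> \<omega>) \<ominus> (a \<ominus> b \<ominus> b \<otimes> \<omega>))"
    have c: "c = b" unfolding c_def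
      by (rule eq_by_multiple[OF _ k, of _ _ b],
          reify ring_reify, rule peqI, simp, simp, simp, code_simp, simp, simp, simp)
    have "a \<oplus> b \<otimes> \<omega> \<ominus> b \<otimes> \<omega> = a"
      by (simp add: a_minus_def a_assoc r_neg)
    then show ?case by (simp add: eq c_def[symmetric] c)
  next
    case (7 x)
    then obtain r s where eq: "x = (r, s)" and [simp]: "r \<in> carrier R" "s \<in> carrier R"
      by auto
    define c where "c = k \<otimes> (r \<ominus> s)"
    have [simp]: "c \<in> carrier R" by (simp add: c_def)
    have "r \<ominus> c \<otimes> \<omega> \<ominus> c \<ominus> c \<otimes> \<omega> = s" unfolding c_def
      by (rule eq_by_multiple[OF _ k, of _ _ "\<ominus> (r \<ominus> s)"],
          reify ring_reify, rule peqI, simp, simp, simp, code_simp, simp, simp, simp)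
    moreover have "r \<ominus> c \<otimes> \<omega> \<oplus> c \<otimes> \<omega> = r"
      by (simp add: a_minus_def a_assoc l_neg)
    ultimately show ?case by (simp add: eq c_def[symmetric])
  qed (auto simp: quad_ext_monoid a_minus_def)
qed

text \<open>With $g$ the class of $X$, $1 + g$ squares to zero in characteristic 2, so $x \mapsto 1 + x(1 + g)$
  is a homomorphism from the additive group.\<close>

lemma units_of_quad_ext_char2:
  assumes two: "\<one> \<oplus> \<one> = \<zero>"
  shows "units_of (c2_ext R) \<cong> units_of R \<times>\<times> add_monoid R"
proof -
  let ?A = "units_of R \<times>\<times> add_monoid R"
  \<comment> \<open>The coordinates of u(1 + x(1 + g)).\<close>
  let ?h = "\<lambda>(u, x). (u \<oplus> u \<otimes> x, u \<otimes> x)"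
  have A: "group ?A"
    by (intro DirProd_group units_group a_group)
  have "?A \<cong> units_of (c2_ext R)"
  proof (rule units_of_iso_surj_units[OF A, where h = ?h])
    show "?h \<in> hom ?A (c2_ext R)"
    proof (rule homI)
      fix s t assume "s \<in> carrier ?A" "t \<in> carrier ?A"
      then obtain u x v y where eq: "s = (u, x)" "t = (v, y)" "u \<in> Units R" "v \<in> Units R"
        and [simp]: "x \<in> carrier R" "y \<in> carrier R"
        by (auto simp: units_of_def)
      then have [simp]: "u \<in> carrier R" "v \<in> carrier R" by auto
      show "?h (s \<otimes>\<^bsub>?A\<^esub> t) = ?h s \<otimes>\<^bsub>c2_ext R\<^esub> ?h t"
        unfolding eq(1,2) quad_ext_simps prod.case mult_DirProd prod.inject units_of_mult monoid.simps
        by (intro conjI; (rule eq_by_multiple[OF _ two, of _ _ "\<ominus> (u \<otimes> v \<otimes> x \<otimes> y)"],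
            reify ring_reify, rule peqI, simp, simp, simp, code_simp, simp, simp, simp))
    qed (auto simp: units_of_def)
    show "inj_on ?h (carrier ?A)"
    proof (rule inj_onI)
      fix s t assume "s \<in> carrier ?A" "t \<in> carrier ?A" and h: "?h s = ?h t"
      then obtain u x v y where eq: "s = (u, x)" "t = (v, y)" "u \<in> Units R" "v \<in> Units R"
        and [simp]: "x \<in> carrier R" "y \<in> carrier R"
        by (auto simp: units_of_def)
      then have [simp]: "u \<in> carrier R" "v \<in> carrier R" by auto
      have ux: "u \<oplus> u \<otimes> x = v \<oplus> v \<otimes> y" "u \<otimes> x = v \<otimes> y"
        using h unfolding eq(1,2) prod.case prod.inject by blast+
      have "u = v"
        using ux(1)[folded ux(2)] by simp
      then show "s = t" using ux eq by simp
    qed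
    show "y \<in> ?h ` carrier ?A" if unit: "y \<in> Units (c2_ext R)" for y
    proof -
      obtain a b c d where y: "y = (a, b)"
        and [simp]: "a \<in> carrier R" "b \<in> carrier R" "c \<in> carrier R" "d \<in> carrier R"
        and inv: "(a, b) \<otimes>\<^bsub>c2_ext R\<^esub> (c, d) = (\<one>, \<zero>)"
        using unit by (auto simp: Units_def)
      \<comment> \<open>The augmentation g -> 1 is multiplicative, so a + b is invertible with
        inverse c + d. The products with \<open>\<one>\<close> and \<open>\<zero>\<close> are kept
        as \<open>quad_ext_simps\<close> produces them, so that \<open>inv\<close> applies.\<close>
      have "(a \<oplus> b) \<otimes> (c \<oplus> d) =
          (a \<otimes> c \<oplus> \<one> \<otimes> (b \<otimes> d)) \<oplus> (a \<otimes> d \<oplus> b \<otimes> c \<oplus> \<zero> \<otimes> (b \<otimes> d))"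
        by (reify ring_reify, rule peqI, simp, simp, simp, code_simp)
      then have one: "(a \<oplus> b) \<otimes> (c \<oplus> d) = \<one>"
        using inv unfolding quad_ext_simps prod.inject by simp
      then have "a \<oplus> b \<in> Units R"
        using m_comm[of "a \<oplus> b" "c \<oplus> d"] unfolding Units_def by auto
      moreover have "(a \<oplus> b) \<otimes> ((c \<oplus> d) \<otimes> b) = b"
        using one by (simp add: m_assoc[symmetric])
      moreover have "a \<oplus> b \<oplus> b = a"
        by (rule eq_by_multiple[OF _ two, of _ _ b],
            reify ring_reify, rule peqI, simp, simp, simp, code_simp, simp, simp, simp)
      \<comment> \<open>Solving u + ux = a and ux = b in characteristic 2 gives u = a + b and x =
        b/u.\<close>
      ultimately show ?thesis
        unfolding y by (intro image_eqI[where x = "(a \<oplus> b, (c \<oplus> d) \<otimes> b)"])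
          (simp_all add: units_of_def)
    qed
  qed (simp_all add: quad_ext_monoid units_of_def)
  then show ?thesis by (rule group.iso_sym[OF A])
qed

text \<open>With $\tau = X - 1$ and $\tau^3 = 0$, the correction $-x^2$ makes
  $(x, y) \mapsto 1 + x \tau + (y - x^2) \tau^2$ a homomorphism from the additive group.\<close>

lemma units_of_cyc3_ext_char3:
  assumes three: "\<one> \<oplus> \<one> \<oplus> \<one> = \<zero>"
  shows "units_of (cyc3_ext R) \<cong> units_of R \<times>\<times> (add_monoid R \<times>\<times> add_monoid R)"
proof -
  let ?A = "units_of R \<times>\<times> (add_monoid R \<times>\<times> add_monoid R)"
  \<comment> \<open>Modulo 3, \<tau>^2 = 1 + X + X^2, so 1 + x\<tau> + w\<tau>^2 has the coordinates
    1 - x + w, x + w, w; here w = y - x^2. A product of two such elements has the cross term xx' at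
    \<tau>^2, while -(x + x')^2 contributes -2xx'; the two agree modulo 3.\<close>
  let ?h = "\<lambda>(u, x, y). (u \<otimes> (\<one> \<ominus> x \<oplus> (y \<ominus> x \<otimes> x)), u \<otimes> (x \<oplus> (y \<ominus> x \<otimes> x)), u \<otimes> (y \<ominus> x \<otimes> x))"
  have A: "group ?A"
    by (intro DirProd_group units_group a_group)
  \<comment> \<open>The augmentation X -> 1 kills \<tau>, so the sum of the coordinates recovers
    \<open>u\<close>.\<close>
  have sum: "u \<otimes> (\<one> \<ominus> x \<oplus> (y \<ominus> x \<otimes> x)) \<oplus> u \<otimes> (x \<oplus> (y \<ominus> x \<otimes> x)) \<oplus> u \<otimes> (y \<ominus> x \<otimes> x) = u"
    if [simp]: "u \<in> carrier R" "x \<in> carrier R" "y \<in> carrier R" for u x y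
    by (rule eq_by_multiple[OF _ three, of _ _ "u \<otimes> (y \<ominus> x \<otimes> x)"],
        reify ring_reify, rule peqI, simp, simp, simp, code_simp, simp, simp, simp)
  have "?A \<cong> units_of (cyc3_ext R)"
  proof (rule units_of_iso_surj_units[OF A, where h = ?h])
    show "?h \<in> hom ?A (cyc3_ext R)"
    proof (rule homI)
      fix s t assume "s \<in> carrier ?A" "t \<in> carrier ?A"
      then obtain u x z v y w where eq: "s = (u, x, z)" "t = (v, y, w)"
        "u \<in> Units R" "v \<in> Units R"
        and [simp]: "x \<in> carrier R" "z \<in> carrier R" "y \<in> carrier R" "w \<in> carrier R"
        by (auto simp: units_of_def)
      then have [simp]: "u \<in> carrier R" "v \<in> carrier R" by auto
      let ?a = "z \<ominus> x \<otimes> x" and ?b = "w \<ominus> y \<otimes> y"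
      show "?h (s \<otimes>\<^bsub>?A\<^esub> t) = ?h s \<otimes>\<^bsub>cyc3_ext R\<^esub> ?h t"
        unfolding eq(1,2) cyc3_ext_simps prod.case mult_DirProd prod.inject units_of_mult monoid.simps
        \<comment> \<open>Each cofactor is one third of the difference of the two sides, coordinate
          by coordinate.\<close>
        by (intro conjI,
            (rule eq_by_multiple[OF _ three, of _ _ "\<ominus> (u \<otimes> v \<otimes> (x \<otimes> y \<oplus> ?a \<otimes> ?b))"],
                reify ring_reify, rule peqI, simp, simp, simp, code_simp, simp, simp, simp),
            (rule eq_by_multiple[OF _ three, of _ _ "\<ominus> (u \<otimes> v \<otimes> (?a \<otimes> ?b))"],
                reify ring_reify, rule peqI, simp, simp, simp, code_simp, simp, simp, simp),
            (rule eq_by_multiple[OF _ three, of _ _ "\<ominus> (u \<otimes> v \<otimes> (x \<otimes> y \<oplus> ?a \<otimes> ?b))"],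
                reify ring_reify, rule peqI, simp, simp, simp, code_simp, simp, simp, simp))
    qed (auto simp: units_of_def)
    show "inj_on ?h (carrier ?A)"
    proof (rule inj_onI)
      fix s t assume "s \<in> carrier ?A" "t \<in> carrier ?A" and h: "?h s = ?h t"
      then obtain u x z v y w where eq: "s = (u, x, z)" "t = (v, y, w)" "u \<in> Units R" "v \<in> Units R"
        and [simp]: "x \<in> carrier R" "z \<in> carrier R" "y \<in> carrier R" "w \<in> carrier R"
        by (auto simp: units_of_def)
      then have [simp]: "u \<in> carrier R" "v \<in> carrier R" by auto
      have h': "u \<otimes> (\<one> \<ominus> x \<oplus> (z \<ominus> x \<otimes> x)) = v \<otimes> (\<one> \<ominus> y \<oplus> (w \<ominus> y \<otimes> y))"
        "u \<otimes> (x \<oplus> (z \<ominus> x \<otimes> x)) = v \<otimes> (y \<oplus> (w \<ominus> y \<otimes> y))"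
        "u \<otimes> (z \<ominus> x \<otimes> x) = v \<otimes> (w \<ominus> y \<otimes> y)"
        using h unfolding eq(1,2) prod.case prod.inject by blast+
      have "u = v"
        using sum[of u x z, unfolded h'] sum[of v y w] by simp
      then have zw: "z \<ominus> x \<otimes> x = w \<ominus> y \<otimes> y"
        and "x \<oplus> (z \<ominus> x \<otimes> x) = y \<oplus> (w \<ominus> y \<otimes> y)"
        using h'(2,3) eq(3,4) by simp_all
      then have "x = y" by simp
      moreover then have "z = w"
        using zw by (simp add: a_minus_def)
      ultimately show "s = t" using \<open>u = v\<close> eq by simp
    qed
    show "y \<in> ?h ` carrier ?A" if unit: "y \<in> Units (cyc3_ext R)" for y
    proof -
      obtain a b c d e f where y: "y = (a, b, c)"
        and [simp]: "a \<in> carrier R" "b \<in> carrier R" "c \<in> carrier R"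
          "d \<in> carrier R" "e \<in> carrier R" "f \<in> carrier R"
        and inv: "(a, b, c) \<otimes>\<^bsub>cyc3_ext R\<^esub> (d, e, f) = (\<one>, \<zero>, \<zero>)"
        using unit by (auto simp: Units_def)
      define u v where "u = a \<oplus> b \<oplus> c" and "v = d \<oplus> e \<oplus> f"
      have [simp]: "u \<in> carrier R" "v \<in> carrier R"
        by (simp_all add: u_def v_def)
      \<comment> \<open>The augmentation of a product is the product of the augmentations, so
        \<open>v\<close> is the inverse of \<open>u\<close>.\<close>
      have "u \<otimes> v = (a \<otimes> d \<oplus> b \<otimes> f \<oplus> c \<otimes> e) \<oplus> (a \<otimes> e \<oplus> b \<otimes> d \<oplus> c \<otimes> f) \<oplus>
          (a \<otimes> f \<oplus> b \<otimes> e \<oplus> c \<otimes> d)"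
        unfolding u_def v_def by (reify ring_reify, rule peqI, simp, simp, simp, code_simp)
      then have one: "u \<otimes> v = \<one>"
        using inv unfolding cyc3_ext_simps prod.inject by simp
      then have "u \<in> Units R"
        using m_comm[of u v] unfolding Units_def by auto
      \<comment> \<open>Obtained from uz = c and u(x + z) = b. Here \<open>z\<close> is the full
        coefficient of \<tau>^2 after division by \<open>u\<close>, so undoing the correction puts z
        + x^2 into the preimage.\<close>
      define x z where "x = v \<otimes> (b \<ominus> c)" and "z = v \<otimes> c"
      have [simp]: "x \<in> carrier R" "z \<in> carrier R"
        by (simp_all add: x_def z_def)
      have ux: "u \<otimes> x = b \<ominus> c" and uz: "u \<otimes> z = c"
        unfolding x_def z_def using one by (simp_all add: m_assoc[symmetric])
      have z: "z \<oplus> x \<otimes> x \<ominus> x \<otimes> x = z"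
        by (simp add: a_minus_def a_assoc r_neg)
      have "u \<otimes> (\<one> \<ominus> x \<oplus> z) = u \<ominus> u \<otimes> x \<oplus> u \<otimes> z"
        by (reify ring_reify, rule peqI, simp, simp, simp, code_simp)
      also have "\<dots> = a"
        unfolding ux uz unfolding u_def
        by (rule eq_by_multiple[OF _ three, of _ _ c],
            reify ring_reify, rule peqI, simp, simp, simp, code_simp, simp, simp, simp)
      finally have "u \<otimes> (\<one> \<ominus> x \<oplus> z) = a" .
      moreover have "u \<otimes> (x \<oplus> z) = b"
        by (simp add: r_distr ux uz a_minus_def a_assoc l_neg)
      ultimately show ?thesis
        unfolding y using \<open>u \<in> Units R\<close>
        by (intro image_eqI[where x = "(u, x, z \<oplus> x \<otimes> x)"]) (simp_all add: units_of_def z uz)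
    qed
  qed (simp_all add: cyc3_ext_monoid units_of_def a_minus_def)
  then show ?thesis by (rule group.iso_sym[OF A])
qed

end

text \<open>The norm of $a + bX$ is $a^2 - ab + b^2$, which vanishes for $b \neq 0$ only if $-a/b$ is a root of $X^2 + X + 1$.\<close>

lemma (in field) quad_ext_field:
  assumes no_root: "\<And>z. z \<in> carrier R \<Longrightarrow> z \<otimes> z \<oplus> z \<oplus> \<one> \<noteq> \<zero>"
  shows "field (quad_ext R (\<ominus> \<one>) (\<ominus> \<one>))"
proof -
  have norm: "a \<otimes> a \<ominus> a \<otimes> b \<oplus> b \<otimes> b \<noteq> \<zero>"
    if [simp]: "a \<in> carrier R" "b \<in> carrier R" and nz: "(a, b) \<noteq> (\<zero>, \<zero>)" for a b
  proof (cases "b = \<zero>")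
    case True
    then show ?thesis using nz by (simp add: a_minus_def integral_iff)
  next
    case False
    then obtain i where [simp]: "i \<in> carrier R" and "b \<otimes> i = \<one>"
      using field_Units by (metis DiffI Units_inv_closed Units_r_inv empty_iff insert_iff \<open>b \<in> carrier R\<close>)
    then have i: "b \<otimes> i \<ominus> \<one> = \<zero>" by (simp add: r_right_minus_eq)
    have "\<ominus> (a \<otimes> i) \<otimes> \<ominus> (a \<otimes> i) \<oplus> \<ominus> (a \<otimes> i) \<oplus> \<one> =
        (a \<otimes> a \<ominus> a \<otimes> b \<oplus> b \<otimes> b) \<otimes> (i \<otimes> i)"
      by (rule eq_by_multiple[OF _ i, of _ _ "a \<otimes> i \<ominus> b \<otimes> i \<ominus> \<one>"],
          reify ring_reify, rule peqI, simp, simp, simp, code_simp, simp, simp, simp)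
    then show ?thesis using no_root[of "\<ominus> (a \<otimes> i)"] by auto
  qed
  show ?thesis
  proof (rule cring.cring_fieldI2)
    show "cring (quad_ext R (\<ominus> \<one>) (\<ominus> \<one>))"
      by (rule quad_ext_cring) simp_all
    fix x assume "x \<in> carrier (quad_ext R (\<ominus> \<one>) (\<ominus> \<one>))" "x \<noteq> \<zero>\<^bsub>quad_ext R (\<ominus> \<one>) (\<ominus> \<one>)\<^esub>"
    then obtain a b where x: "x = (a, b)" "(a, b) \<noteq> (\<zero>, \<zero>)"
      and [simp]: "a \<in> carrier R" "b \<in> carrier R" by auto
    define n where "n = a \<otimes> a \<ominus> a \<otimes> b \<oplus> b \<otimes> b"
    have "n \<in> carrier R" "n \<noteq> \<zero>"
      using norm[of a b] x(2) by (simp_all add: n_def)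
    then obtain j where [simp]: "j \<in> carrier R" and j: "n \<otimes> j = \<one>"
      using field_Units by (metis DiffI Units_inv_closed Units_r_inv empty_iff insert_iff)
    \<comment> \<open>Conjugation X -> -1 - X sends a + bX to (a - b) - bX, and the product of the
      two is the norm \<open>n\<close>; the inverse is therefore the conjugate times
      \<open>j\<close>.\<close>
    have "a \<otimes> ((a \<ominus> b) \<otimes> j) \<oplus> \<ominus> \<one> \<otimes> (b \<otimes> \<ominus> (b \<otimes> j)) = n \<otimes> j"
      unfolding n_def by (reify ring_reify, rule peqI, simp, simp, simp, code_simp)
    moreover have "a \<otimes> \<ominus> (b \<otimes> j) \<oplus> b \<otimes> ((a \<ominus> b) \<otimes> j) \<oplus> \<ominus> \<one> \<otimes> (b \<otimes> \<ominus> (b \<otimes> j)) = \<zero>"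
      by (reify ring_reify, rule peqI, simp, simp, simp, code_simp)
    ultimately show "\<exists>y\<in>carrier (quad_ext R (\<ominus> \<one>) (\<ominus> \<one>)).
        x \<otimes>\<^bsub>quad_ext R (\<ominus> \<one>) (\<ominus> \<one>)\<^esub> y = \<one>\<^bsub>quad_ext R (\<ominus> \<one>) (\<ominus> \<one>)\<^esub>"
      unfolding x(1) quad_ext_simps j
      by (intro bexI[where x = "((a \<ominus> b) \<otimes> j, \<ominus> (b \<otimes> j))"]) simp_all
  qed simp
qed

text \<open>The unit group is cyclic of order 3m, so the image of \<open>m\<close> has order 3; in
  the factorisation X^3 - 1 = (X - 1)(X^2 + X + 1) it must annihilate the second factor.\<close>

lemma (in field) exists_omega:
  assumes fin: "finite (carrier R)" and card: "card (carrier R) mod 3 = 1"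
  shows "\<exists>\<omega>\<in>carrier R. \<omega> \<otimes> \<omega> \<oplus> \<omega> \<oplus> \<one> = \<zero>"
proof -
  define m where "m = card (carrier R) div 3"
  have n: "card (carrier R) - 1 = 3 * m"
    using card unfolding m_def by presburger
  \<comment> \<open>Two distinct elements exclude m = 0, where \<omega> would be 1.\<close>
  have "card {\<zero>, \<one>} \<le> card (carrier R)"
    by (rule card_mono[OF fin]) auto
  then have "m > 0" using n by simp
  have "integer_mod_group (3 * m) \<cong> units_of R"
    using units_of_iso_cyclic[OF fin] unfolding n by (rule group.iso_sym[OF units_group])
  then obtain h where h: "h \<in> iso (integer_mod_group (3 * m)) (units_of R)"
    by (auto simp: is_iso_def)
  then have hom: "h \<in> hom (integer_mod_group (3 * m)) (units_of R)"
    and inj: "inj_on h (carrier (integer_mod_group (3 * m)))"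
    by (auto simp: iso_def bij_betw_def)
  have h0: "h 0 = \<one>"
    using hom_one[OF hom group_integer_mod_group units_group] by (simp add: units_of_one)
  define \<omega> where "\<omega> = h (int m)"
  have m: "int m \<in> carrier (integer_mod_group (3 * m))"
    "2 * int m \<in> carrier (integer_mod_group (3 * m))"
    using \<open>m > 0\<close> by (auto simp: carrier_integer_mod_group)
  have "\<omega> \<in> Units R"
    using hom_in_carrier[OF hom m(1)] by (simp add: \<omega>_def units_of_carrier)
  then have [simp]: "\<omega> \<in> carrier R" by auto
  have "h (2 * int m) = \<omega> \<otimes> \<omega>"
    using hom_mult[OF hom m(1) m(1)] m(2) \<open>m > 0\<close>
    by (simp add: \<omega>_def units_of_mult carrier_integer_mod_group)
  then have "\<omega> \<otimes> \<omega> \<otimes> \<omega> = h ((2 * int m + int m) mod (3 * int m))"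
    using hom_mult[OF hom m(2) m(1)] by (simp add: \<omega>_def units_of_mult)
  then have cube: "\<omega> \<otimes> \<omega> \<otimes> \<omega> = \<one>" by (simp add: h0)
  have "(\<omega> \<ominus> \<one>) \<otimes> (\<omega> \<otimes> \<omega> \<oplus> \<omega> \<oplus> \<one>) = \<omega> \<otimes> \<omega> \<otimes> \<omega> \<ominus> \<one>"
    by (reify ring_reify, rule peqI, simp, simp, simp, code_simp)
  then have "(\<omega> \<ominus> \<one>) \<otimes> (\<omega> \<otimes> \<omega> \<oplus> \<omega> \<oplus> \<one>) = \<zero>"
    by (simp add: cube r_right_minus_eq)
  moreover have "\<omega> \<noteq> \<one>"
    using inj_onD[OF inj, of "int m" 0] m(1) \<open>m > 0\<close> h0 by (auto simp: \<omega>_def)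
  then have "\<omega> \<ominus> \<one> \<noteq> \<zero>" by (simp add: r_right_minus_eq)
  ultimately have "\<omega> \<otimes> \<omega> \<oplus> \<omega> \<oplus> \<one> = \<zero>"
    by (simp add: integral_iff)
  then show ?thesis by (intro bexI[of _ \<omega>]) simp_all
qed

text \<open>A root satisfies z^3 = 1, while the unit group has order 3m + 1; together these force z
  = 1, and the equation then says 3 = 0.\<close>

lemma (in field) no_omega:
  assumes fin: "finite (carrier R)" and card: "card (carrier R) mod 3 = 2"
    and three: "\<one> \<oplus> \<one> \<oplus> \<one> \<noteq> \<zero>" and z: "z \<in> carrier R"
  shows "z \<otimes> z \<oplus> z \<oplus> \<one> \<noteq> \<zero>"
proof
  assume eq: "z \<otimes> z \<oplus> z \<oplus> \<one> = \<zero>"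
  note [simp] = z
  have cube: "z \<otimes> z \<otimes> z = \<one>"
    by (rule eq_by_multiple[OF _ eq, of _ _ "z \<ominus> \<one>"],
        reify ring_reify, rule peqI, simp, simp, simp, code_simp, simp, simp, simp)
  then have "z \<noteq> \<zero>" by auto
  then have unit: "z \<in> Units R" using field_Units by simp
  define m where "m = card (carrier R) div 3"
  have "card (Units R) = card (carrier R) - 1"
    using fin by (simp add: field_Units)
  also have "\<dots> = 3 * m + 1"
    using card unfolding m_def by presburger
  finally have "z [^] (3 * m + 1) = \<one>"
    using units_power_order_eq_one[OF _ unit] fin by (simp add: field_Units)
  moreover have "z [^] (3 * m) = \<one>"
  proof -
    have "z [^] (3 * m) = (z [^] (3::nat)) [^] m" by (simp add: nat_pow_pow)
    also have "z [^] (3::nat) = \<one>" using cube by (simp add: numeral_3_eq_3)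
    finally show ?thesis by simp
  qed
  ultimately have "z = \<one>" by (simp add: nat_pow_mult[symmetric])
  then show False using eq three by simp
qed

section \<open>Group algebras\<close>

lemma group_algebra_simps [simp]:
  "carrier (group_algebra F G) = carrier G \<rightarrow>\<^sub>E carrier F"
  "a \<otimes>\<^bsub>group_algebra F G\<^esub> b =
     (\<lambda>g\<in>carrier G. \<Oplus>\<^bsub>F\<^esub>h\<in>carrier G. a h \<otimes>\<^bsub>F\<^esub> b (inv\<^bsub>G\<^esub> h \<otimes>\<^bsub>G\<^esub> g))"
  "\<one>\<^bsub>group_algebra F G\<^esub> = (\<lambda>g\<in>carrier G. if g = \<one>\<^bsub>G\<^esub> then \<one>\<^bsub>F\<^esub> else \<zero>\<^bsub>F\<^esub>)"
  "\<zero>\<^bsub>group_algebra F G\<^esub> = (\<lambda>g\<in>carrier G. \<zero>\<^bsub>F\<^esub>)"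
  "a \<oplus>\<^bsub>group_algebra F G\<^esub> b = (\<lambda>g\<in>carrier G. a g \<oplus>\<^bsub>F\<^esub> b g)"
  by (simp_all add: group_algebra_def)

text \<open>Elements are functions on the group, so pulling back along \<psi> reverses its
  direction; convolution survives by reindexing the sum.\<close>

lemma (in cring) group_algebra_ring_iso:
  assumes G: "group G" and H: "group H" and \<psi>: "\<psi> \<in> iso H G"
  shows "(\<lambda>f. \<lambda>h\<in>carrier H. f (\<psi> h)) \<in> ring_iso (group_algebra R G) (group_algebra R H)"
proof -
  interpret G: group G by fact
  interpret H: group H by fact
  interpret \<psi>: group_hom H G \<psi>
    using \<psi> G H by (intro group_hom.intro group_hom_axioms.intro) (auto simp: iso_def)
  have img: "\<psi> ` carrier H = carrier G" and inj: "inj_on \<psi> (carrier H)"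
    using \<psi> by (auto simp: iso_def bij_betw_def)
  let ?T = "\<lambda>f. \<lambda>h\<in>carrier H. f (\<psi> h)"
  let ?\<chi> = "inv_into (carrier H) \<psi>"
  show ?thesis
  proof (rule ring_iso_memI)
    fix a b assume ab: "a \<in> carrier (group_algebra R G)" "b \<in> carrier (group_algebra R G)"
    show "?T (a \<otimes>\<^bsub>group_algebra R G\<^esub> b) = ?T a \<otimes>\<^bsub>group_algebra R H\<^esub> ?T b"
    proof
      fix h
      show "?T (a \<otimes>\<^bsub>group_algebra R G\<^esub> b) h = (?T a \<otimes>\<^bsub>group_algebra R H\<^esub> ?T b) h"
      proof (cases "h \<in> carrier H")
        case h: True
        have cl: "a k \<otimes> b (inv\<^bsub>G\<^esub> k \<otimes>\<^bsub>G\<^esub> \<psi> h) \<in> carrier R" if "k \<in> carrier G" for k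
          using that h PiE_mem[of a "carrier G" "\<lambda>_. carrier R"] PiE_mem[of b "carrier G" "\<lambda>_. carrier R"] ab
          by simp
        have "(\<Oplus>k\<in>carrier G. a k \<otimes> b (inv\<^bsub>G\<^esub> k \<otimes>\<^bsub>G\<^esub> \<psi> h)) =
            (\<Oplus>k\<in>carrier H. a (\<psi> k) \<otimes> b (inv\<^bsub>G\<^esub> \<psi> k \<otimes>\<^bsub>G\<^esub> \<psi> h))"
          unfolding img[symmetric] by (rule finsum_reindex[OF _ inj]) (use cl in auto)
        also have "\<dots> = (\<Oplus>k\<in>carrier H. ?T a k \<otimes> ?T b (inv\<^bsub>H\<^esub> k \<otimes>\<^bsub>H\<^esub> h))"
          using cl h by (intro finsum_cong') auto
        finally show ?thesis using h by simp
      qed simp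
    qed
  next
    show "bij_betw ?T (carrier (group_algebra R G)) (carrier (group_algebra R H))"
    proof (rule bij_betw_byWitness[where f' = "\<lambda>f. \<lambda>g\<in>carrier G. f (?\<chi> g)"])
      show "\<forall>f\<in>carrier (group_algebra R G). (\<lambda>g\<in>carrier G. ?T f (?\<chi> g)) = f"
      proof (intro ballI ext)
        fix f g assume "f \<in> carrier (group_algebra R G)"
        then show "(\<lambda>g\<in>carrier G. ?T f (?\<chi> g)) g = f g"
          using img f_inv_into_f[of g \<psi> "carrier H"] inv_into_into[of g \<psi> "carrier H"] PiE_arb[of f _ _ g]
          by (cases "g \<in> carrier G") auto
      qed
      show "\<forall>f\<in>carrier (group_algebra R H). ?T (\<lambda>g\<in>carrier G. f (?\<chi> g)) = f"
      proof (intro ballI ext)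
        fix f h assume "f \<in> carrier (group_algebra R H)"
        then show "?T (\<lambda>g\<in>carrier G. f (?\<chi> g)) h = f h"
          using inj PiE_arb[of f _ _ h] by (cases "h \<in> carrier H") auto
      qed
    qed (use img inv_into_into[of _ \<psi> "carrier H"] in \<open>auto simp: PiE_mem\<close>)
  qed (use inj in \<open>auto simp: fun_eq_iff inj_on_eq_iff[OF inj, of _ "\<one>\<^bsub>H\<^esub>", simplified]\<close>)
qed

lemma (in abelian_monoid) finsum_Times_two:
  assumes "finite B" "f \<in> {0..<2::int} \<times> B \<rightarrow> carrier G"
  shows "finsum G f ({0..<2} \<times> B) = (\<Oplus>k\<in>B. f (0, k)) \<oplus> (\<Oplus>k\<in>B. f (1, k))"
proof -
  have two: "{0..<2::int} \<times> B = Pair 0 ` B \<union> Pair 1 ` B"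
  proof -
    have "{0..<2::int} = {0, 1}" by auto
    then show ?thesis by auto
  qed
  have "finsum G f ({0..<2} \<times> B) = finsum G f (Pair 0 ` B) \<oplus> finsum G f (Pair 1 ` B)"
    unfolding two using assms by (intro finsum_Un_disjoint) auto
  also have "finsum G f (Pair 0 ` B) = (\<Oplus>k\<in>B. f (0, k))"
    using assms by (intro finsum_reindex) (auto simp: inj_on_def)
  also have "finsum G f (Pair 1 ` B) = (\<Oplus>k\<in>B. f (1, k))"
    using assms by (intro finsum_reindex) (auto simp: inj_on_def)
  finally show ?thesis .
qed

text \<open>\<open>S\<close> is any model of R[H], identified with it by \<phi>; the conclusion has
  the form of the hypothesis one level higher, which permits iteration. The pair (s, t) stands for s
  + tX, with X the element 1 of the integers modulo 2.\<close>

lemma (in cring) group_algebra_DirProd_two: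
  assumes H: "group H" and fin: "finite (carrier H)" and S: "cring S"
    and \<phi>: "\<phi> \<in> ring_iso S (group_algebra R H)"
  shows "(\<lambda>(s, t). \<lambda>x\<in>carrier (integer_mod_group 2 \<times>\<times> H). (if fst x = 0 then \<phi> s else \<phi> t) (snd x))
    \<in> ring_iso (c2_ext S) (group_algebra R (integer_mod_group 2 \<times>\<times> H))"
proof -
  interpret H: group H by fact
  interpret S: cring S by fact
  let ?K = "integer_mod_group 2 \<times>\<times> H"
  let ?h = "\<lambda>(s, t). \<lambda>x\<in>carrier ?K. (if fst x = 0 then \<phi> s else \<phi> t) (snd x)"
  have two: "carrier (integer_mod_group 2) = {0..<2}"
    by (simp add: carrier_integer_mod_group)
  have one_K: "\<one>\<^bsub>?K\<^esub> = (0, \<one>\<^bsub>H\<^esub>)" by simp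
  have \<phi>_ext: "\<phi> s \<in> carrier H \<rightarrow>\<^sub>E carrier R" if "s \<in> carrier S" for s
    using ring_iso_memE(1)[OF \<phi> that] by simp
  have \<phi>_in: "\<phi> s k \<in> carrier R" if "s \<in> carrier S" "k \<in> carrier H" for s k
    using PiE_mem[OF \<phi>_ext[OF that(1)] that(2)] .
  have \<phi>_mult: "\<phi> (s \<otimes>\<^bsub>S\<^esub> t) k = (\<Oplus>l\<in>carrier H. \<phi> s l \<otimes> \<phi> t (inv\<^bsub>H\<^esub> l \<otimes>\<^bsub>H\<^esub> k))"
    if "s \<in> carrier S" "t \<in> carrier S" "k \<in> carrier H" for s t k
    using ring_iso_memE(2)[OF \<phi> that(1,2)] that(3) by simp
  have \<phi>_add: "\<phi> (s \<oplus>\<^bsub>S\<^esub> t) k = \<phi> s k \<oplus> \<phi> t k"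
    if "s \<in> carrier S" "t \<in> carrier S" "k \<in> carrier H" for s t k
    using ring_iso_memE(3)[OF \<phi> that(1,2)] that(3) by simp
  \<comment> \<open>Preservation of zero is not part of \<open>ring_iso\<close>; it follows by
    cancelling in \<phi>(0) = \<phi>(0) + \<phi>(0).\<close>
  have \<phi>_zero: "\<phi> \<zero>\<^bsub>S\<^esub> k = \<zero>" if "k \<in> carrier H" for k
    using \<phi>_add[of "\<zero>\<^bsub>S\<^esub>" "\<zero>\<^bsub>S\<^esub>" k] \<phi>_in[of "\<zero>\<^bsub>S\<^esub>" k] that by simp
  have \<phi>_one: "\<phi> \<one>\<^bsub>S\<^esub> k = (if k = \<one>\<^bsub>H\<^esub> then \<one> else \<zero>)" if "k \<in> carrier H" for k
    using ring_iso_memE(4)[OF \<phi>] that by simp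
  have bij: "inj_on \<phi> (carrier S)" "\<phi> ` carrier S = carrier H \<rightarrow>\<^sub>E carrier R"
    using ring_iso_memE(5)[OF \<phi>] by (auto simp: bij_betw_def)
  have h_in: "?h x \<in> carrier (group_algebra R ?K)" if x: "x \<in> carrier (c2_ext S)" for x
  proof -
    obtain s t where "x = (s, t)" "s \<in> carrier S" "t \<in> carrier S"
      using x by auto
    then show ?thesis by (simp add: restrict_PiE_iff) (auto simp: \<phi>_in)
  qed
  show ?thesis
  proof (rule ring_iso_memI)
    fix x assume "x \<in> carrier (c2_ext S)"
    then show "?h x \<in> carrier (group_algebra R ?K)"
      by (rule h_in)
  next
    fix x y assume "x \<in> carrier (c2_ext S)" "y \<in> carrier (c2_ext S)"
    then obtain a b c d where eq: "x = (a, b)" "y = (c, d)"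
      and [simp]: "a \<in> carrier S" "b \<in> carrier S" "c \<in> carrier S" "d \<in> carrier S"
      by auto
    have xy: "x \<otimes>\<^bsub>c2_ext S\<^esub> y =
        (a \<otimes>\<^bsub>S\<^esub> c \<oplus>\<^bsub>S\<^esub> b \<otimes>\<^bsub>S\<^esub> d, a \<otimes>\<^bsub>S\<^esub> d \<oplus>\<^bsub>S\<^esub> b \<otimes>\<^bsub>S\<^esub> c)"
      by (simp add: eq)
    show "?h (x \<otimes>\<^bsub>c2_ext S\<^esub> y) = ?h x \<otimes>\<^bsub>group_algebra R ?K\<^esub> ?h y"
    proof
      fix z
      show "?h (x \<otimes>\<^bsub>c2_ext S\<^esub> y) z = (?h x \<otimes>\<^bsub>group_algebra R ?K\<^esub> ?h y) z"
      proof (cases "z \<in> carrier ?K")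
        case True
        then obtain i k where z: "z = (i, k)" "i = 0 \<or> i = 1" and [simp]: "k \<in> carrier H"
          by (force simp: two)
        let ?f = "\<lambda>w. ?h x w \<otimes> ?h y (inv\<^bsub>?K\<^esub> w \<otimes>\<^bsub>?K\<^esub> z)"
        \<comment> \<open>The first component i - j vanishes modulo 2 exactly when i = j, and then
          the right factor of the convolution comes from \<open>c\<close>, otherwise from
          \<open>d\<close>.\<close>
        have inv: "inv\<^bsub>?K\<^esub> (j, l) \<otimes>\<^bsub>?K\<^esub> z = ((i - j) mod 2, inv\<^bsub>H\<^esub> l \<otimes>\<^bsub>H\<^esub> k)"
          if "j = 0 \<or> j = 1" "l \<in> carrier H" for j l
          using that z by (auto simp: two)
        have f: "?f (j, l) = (if j = 0 then \<phi> a else \<phi> b) l \<otimes>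
            (if i = j then \<phi> c else \<phi> d) (inv\<^bsub>H\<^esub> l \<otimes>\<^bsub>H\<^esub> k)"
          if "j = 0 \<or> j = 1" "l \<in> carrier H" for j l
          unfolding inv[OF that] using that z by (auto simp: eq two)
        have f_in: "?f \<in> {0..<2} \<times> carrier H \<rightarrow> carrier R"
        proof
          fix w assume "w \<in> {0..<2::int} \<times> carrier H"
          then obtain j l where w: "w = (j, l)" "j = 0 \<or> j = 1" "l \<in> carrier H"
            by force
          show "?f w \<in> carrier R"
            unfolding w(1) f[OF w(2,3)] using w(3) by (auto simp: \<phi>_in)
        qed
        have "(?h x \<otimes>\<^bsub>group_algebra R ?K\<^esub> ?h y) z = finsum R ?f ({0..<2} \<times> carrier H)"
          using True by (simp add: two)
        also have "\<dots> = (\<Oplus>l\<in>carrier H. ?f (0, l)) \<oplus> (\<Oplus>l\<in>carrier H. ?f (1, l))"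
          by (rule finsum_Times_two[OF fin f_in])
        also have "(\<Oplus>l\<in>carrier H. ?f (0, l)) =
            (\<Oplus>l\<in>carrier H. \<phi> a l \<otimes> (if i = 0 then \<phi> c else \<phi> d) (inv\<^bsub>H\<^esub> l \<otimes>\<^bsub>H\<^esub> k))"
          using f[of 0] by (intro finsum_cong') (auto simp: \<phi>_in)
        also have "\<dots> = \<phi> (a \<otimes>\<^bsub>S\<^esub> (if i = 0 then c else d)) k"
          by (simp add: \<phi>_mult)
        also have "(\<Oplus>l\<in>carrier H. ?f (1, l)) =
            (\<Oplus>l\<in>carrier H. \<phi> b l \<otimes> (if i = 1 then \<phi> c else \<phi> d) (inv\<^bsub>H\<^esub> l \<otimes>\<^bsub>H\<^esub> k))"
          using f[of 1] by (intro finsum_cong') (auto simp: \<phi>_in)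
        also have "\<dots> = \<phi> (b \<otimes>\<^bsub>S\<^esub> (if i = 1 then c else d)) k"
          by (simp add: \<phi>_mult)
        also have "\<phi> (a \<otimes>\<^bsub>S\<^esub> (if i = 0 then c else d)) k \<oplus> \<phi> (b \<otimes>\<^bsub>S\<^esub> (if i = 1 then c else d)) k =
            ?h (x \<otimes>\<^bsub>c2_ext S\<^esub> y) z"
          using z(2) True unfolding xy by (auto simp: z(1) \<phi>_add)
        finally show ?thesis by (rule sym)
      qed (simp add: xy)
    qed
  next
    fix x y assume "x \<in> carrier (c2_ext S)" "y \<in> carrier (c2_ext S)"
    then show "?h (x \<oplus>\<^bsub>c2_ext S\<^esub> y) = ?h x \<oplus>\<^bsub>group_algebra R ?K\<^esub> ?h y"
      by (auto simp: fun_eq_iff \<phi>_add)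
  next
    show "?h \<one>\<^bsub>c2_ext S\<^esub> = \<one>\<^bsub>group_algebra R ?K\<^esub>"
      by (auto simp: fun_eq_iff \<phi>_one \<phi>_zero)
  next
    have "inj_on ?h (carrier (c2_ext S))"
    proof (rule inj_onI)
      fix x y assume "x \<in> carrier (c2_ext S)" "y \<in> carrier (c2_ext S)"
        and h: "?h x = ?h y"
      then obtain a b c d where eq: "x = (a, b)" "y = (c, d)"
        and S [simp]: "a \<in> carrier S" "b \<in> carrier S" "c \<in> carrier S" "d \<in> carrier S"
        by auto
      have "\<phi> a k = \<phi> c k \<and> \<phi> b k = \<phi> d k" if "k \<in> carrier H" for k
        using fun_cong[OF h, of "(0, k)"] fun_cong[OF h, of "(1, k)"] that by (simp add: eq two)
      then have "\<phi> a = \<phi> c" "\<phi> b = \<phi> d"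
        using PiE_ext[OF \<phi>_ext \<phi>_ext] S by metis+
      then show "x = y"
        using inj_onD[OF bij(1)] S by (simp add: eq)
    qed
    moreover have "f \<in> ?h ` carrier (c2_ext S)" if f: "f \<in> carrier (group_algebra R ?K)" for f
    proof -
      \<comment> \<open>The slices of \<open>f\<close> over 0 and over 1 are elements of R[H], hence
        values of \<phi>.\<close>
      have lift: "\<exists>s\<in>carrier S. \<phi> s = (\<lambda>k\<in>carrier H. f (j, k))" if j: "j = 0 \<or> j = 1" for j
      proof -
        have "(\<lambda>k\<in>carrier H. f (j, k)) \<in> \<phi> ` carrier S"
          using j f PiE_mem[of f "carrier ?K" "\<lambda>_. carrier R"] unfolding bij(2) by (auto simp: two)
        then show ?thesis by (auto simp: image_iff intro: sym)
      qed
      obtain s where s: "s \<in> carrier S" "\<phi> s = (\<lambda>k\<in>carrier H. f (0, k))"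
        using lift[of 0] by blast
      obtain t where t: "t \<in> carrier S" "\<phi> t = (\<lambda>k\<in>carrier H. f (1, k))"
        using lift[of 1] by blast
      note st = s t
      have "?h (s, t) z = f z" for z
      proof (cases "z \<in> carrier ?K")
        case True
        then obtain i k where "z = (i, k)" "i = 0 \<or> i = 1" "k \<in> carrier H"
          by (force simp: two)
        then show ?thesis by (auto simp: st two)
      next
        case False
        then show ?thesis using f PiE_arb[of f "carrier ?K" "\<lambda>_. carrier R" z] by simp
      qed
      then have "f = ?h (s, t)" by (intro ext) simp
      then show ?thesis by (rule image_eqI) (simp add: s(1) t(1))
    qed
    moreover have "?h x \<in> carrier (group_algebra R ?K)" if "x \<in> carrier (c2_ext S)" for x
      using that by (rule h_in)
    ultimately show "bij_betw ?h (carrier (c2_ext S)) (carrier (group_algebra R ?K))"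
      unfolding bij_betw_def by (intro conjI subset_antisym image_subsetI subsetI)
  qed
qed

lemma (in cring) group_algebra_three:
  "(\<lambda>(a, b, c). \<lambda>i\<in>carrier (integer_mod_group 3). if i = 0 then a else if i = 1 then b else c)
    \<in> ring_iso (cyc3_ext R) (group_algebra R (integer_mod_group 3))"
proof -
  let ?h = "\<lambda>(a, b, c). \<lambda>i\<in>carrier (integer_mod_group 3). if i = (0::int) then a else if i = 1 then b else c"
  have three: "carrier (integer_mod_group 3) = {0, 1, 2}"
    by (auto simp: carrier_integer_mod_group)
  have inv: "inv\<^bsub>integer_mod_group 3\<^esub> 0 = 0" "inv\<^bsub>integer_mod_group 3\<^esub> 1 = 2"
    "inv\<^bsub>integer_mod_group 3\<^esub> 2 = 1"
    by (simp_all add: three)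
  have sum: "finsum R f {0, 1, 2::int} = f 0 \<oplus> f 1 \<oplus> f 2"
    if "f 0 \<in> carrier R" "f 1 \<in> carrier R" "f 2 \<in> carrier R" for f
    using that by (simp add: a_assoc)
  show ?thesis
  proof (rule ring_iso_memI)
    fix x y assume "x \<in> carrier (cyc3_ext R)" "y \<in> carrier (cyc3_ext R)"
    then obtain a b c d e f where eq: "x = (a, b, c)" "y = (d, e, f)"
      and [simp]: "a \<in> carrier R" "b \<in> carrier R" "c \<in> carrier R"
      "d \<in> carrier R" "e \<in> carrier R" "f \<in> carrier R"
      by auto
    show "?h (x \<otimes>\<^bsub>cyc3_ext R\<^esub> y) = ?h x \<otimes>\<^bsub>group_algebra R (integer_mod_group 3)\<^esub> ?h y"
    proof
      fix i
      have "i = 0 \<or> i = 1 \<or> i = 2 \<or> i \<notin> carrier (integer_mod_group 3)"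
        by (auto simp: three)
      then show "?h (x \<otimes>\<^bsub>cyc3_ext R\<^esub> y) i = (?h x \<otimes>\<^bsub>group_algebra R (integer_mod_group 3)\<^esub> ?h y) i"
        by (elim disjE) (simp_all add: eq three inv sum a_ac)
    qed
  next
    fix x y assume "x \<in> carrier (cyc3_ext R)" "y \<in> carrier (cyc3_ext R)"
    then show "?h (x \<oplus>\<^bsub>cyc3_ext R\<^esub> y) = ?h x \<oplus>\<^bsub>group_algebra R (integer_mod_group 3)\<^esub> ?h y"
      by (auto simp: fun_eq_iff)
  next
    show "bij_betw ?h (carrier (cyc3_ext R)) (carrier (group_algebra R (integer_mod_group 3)))"
    proof (rule bij_betw_byWitness[where f' = "\<lambda>f. (f 0, f 1, f 2)"])
      show "\<forall>f\<in>carrier (group_algebra R (integer_mod_group 3)). ?h (f 0, f 1, f 2) = f"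
      proof (intro ballI ext)
        fix f i assume "f \<in> carrier (group_algebra R (integer_mod_group 3))"
        then show "?h (f 0, f 1, f 2) i = f i"
          using PiE_arb[of f "carrier (integer_mod_group 3)" "\<lambda>_. carrier R" i]
          by (auto simp: three)
      qed
    qed (auto simp: three PiE_mem split: if_splits)
  qed (auto simp: three fun_eq_iff split: if_splits)
qed

text \<open>The direct product is bracketed to the right with C_3 innermost, so that each C_2 is
  split off from the left by one use of \<open>group_algebra_DirProd_two\<close>.\<close>

lemma (in cring) units_of_group_algebra_tower:
  assumes G: "group G" and iso: "G \<cong> cyclic_power 2 3 \<times>\<times> integer_mod_group 3"
  shows "units_of (group_algebra R G) \<cong> units_of (c2_ext (c2_ext (c2_ext (cyc3_ext R))))"
proof -
  let ?Z = "integer_mod_group 2" and ?Z3 = "integer_mod_group 3"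
  let ?S0 = "cyc3_ext R"
  let ?S1 = "c2_ext ?S0" let ?S2 = "c2_ext ?S1" let ?S3 = "c2_ext ?S2"
  have S0: "cring ?S0" by (rule cyc3_ext_cring)
  have S1: "cring ?S1" by (intro cring.quad_ext_cring S0 ring.ring_simprules cring.axioms)
  have S2: "cring ?S2" by (intro cring.quad_ext_cring S1 ring.ring_simprules cring.axioms)
  have S3: "cring ?S3" by (intro cring.quad_ext_cring S2 ring.ring_simprules cring.axioms)
  have grp: "group ?Z3" "group (?Z \<times>\<times> ?Z3)" "group (?Z \<times>\<times> ?Z \<times>\<times> ?Z3)" "group (?Z \<times>\<times> ?Z \<times>\<times> ?Z \<times>\<times> ?Z3)"
    by (simp_all add: DirProd_group)
  have fin: "finite (carrier ?Z3)" "finite (carrier (?Z \<times>\<times> ?Z3))" "finite (carrier (?Z \<times>\<times> ?Z \<times>\<times> ?Z3))"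
    by (simp_all add: carrier_integer_mod_group)
  obtain \<phi>0 where \<phi>0: "\<phi>0 \<in> ring_iso ?S0 (group_algebra R ?Z3)"
    using group_algebra_three by blast
  obtain \<phi>1 where \<phi>1: "\<phi>1 \<in> ring_iso ?S1 (group_algebra R (?Z \<times>\<times> ?Z3))"
    using group_algebra_DirProd_two[OF grp(1) fin(1) S0 \<phi>0] by blast
  obtain \<phi>2 where \<phi>2: "\<phi>2 \<in> ring_iso ?S2 (group_algebra R (?Z \<times>\<times> ?Z \<times>\<times> ?Z3))"
    using group_algebra_DirProd_two[OF grp(2) fin(2) S1 \<phi>1] by blast
  obtain \<phi>3 where \<phi>3: "\<phi>3 \<in> ring_iso ?S3 (group_algebra R (?Z \<times>\<times> ?Z \<times>\<times> ?Z \<times>\<times> ?Z3))"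
    using group_algebra_DirProd_two[OF grp(3) fin(3) S2 \<phi>2] by blast
  have "cyclic_power 2 (1 + (1 + 1)) \<cong> ?Z \<times>\<times> (?Z \<times>\<times> ?Z)"
    by (rule iso_trans[OF cyclic_power_add DirProd_cong[OF cyclic_power_1
          iso_trans[OF cyclic_power_add DirProd_cong[OF cyclic_power_1 cyclic_power_1]]]])
  moreover have "1 + (1 + 1) = (3::nat)"
    by simp
  ultimately have "cyclic_power 2 3 \<cong> ?Z \<times>\<times> (?Z \<times>\<times> ?Z)"
    by (simp only:)
  then have "G \<cong> (?Z \<times>\<times> (?Z \<times>\<times> ?Z)) \<times>\<times> ?Z3"
    by (rule iso_trans[OF iso DirProd_cong[OF _ iso_refl]])
  then have "G \<cong> ?Z \<times>\<times> ?Z \<times>\<times> ?Z \<times>\<times> ?Z3"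
    by (rule iso_trans[OF iso_trans[OF _ DirProd_assoc] DirProd_cong[OF iso_refl DirProd_assoc]])
  then obtain \<psi> where \<psi>: "\<psi> \<in> iso G (?Z \<times>\<times> ?Z \<times>\<times> ?Z \<times>\<times> ?Z3)"
    by (auto simp: is_iso_def)
  obtain h where h: "h \<in> ring_iso ?S3 (group_algebra R G)"
    using ring_iso_set_trans[OF \<phi>3 group_algebra_ring_iso[OF grp(4) G \<psi>]] by blast
  have monoid: "monoid ?S3"
    by (intro ring.is_monoid cring.axioms S3)
  have "units_of ?S3 \<cong> units_of (group_algebra R G)"
  proof (rule units_of_cong[OF monoid])
    show "h \<in> iso ?S3 (group_algebra R G)"
      using ring_iso_memE[OF h] by (intro isoI homI)
    show "h \<one>\<^bsub>?S3\<^esub> = \<one>\<^bsub>group_algebra R G\<^esub>"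
      by (rule ring_iso_memE(4)[OF h])
  qed
  then show ?thesis
    by (rule group.iso_sym[OF monoid.units_group[OF monoid]])
qed

section \<open>Climbing the tower of quadratic extensions\<close>

lemma (in cring) cring_c2_ext: "cring (c2_ext R)"
  by (simp add: quad_ext_cring)

lemma cyclic_power_add_sym: "cyclic_power n a \<times>\<times> cyclic_power n b \<cong> cyclic_power n (a + b)"
  by (rule group.iso_sym[OF group_cyclic_power cyclic_power_add])

lemma integer_mod_group_cyclic_power_1: "integer_mod_group n \<cong> cyclic_power n 1"
  by (rule group.iso_sym[OF group_cyclic_power cyclic_power_1])

text \<open>Lets the tower in characteristic 2 start with exponent 0. The only element of
  \<open>cyclic_power n 0\<close> is the function that is \<open>undefined\<close>
  everywhere.\<close>

lemma DirProd_cyclic_power_0: "A \<cong> cyclic_power n 0 \<times>\<times> A"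
proof (rule is_isoI, rule isoI)
  show "Pair (\<lambda>_. undefined) \<in> hom A (cyclic_power n 0 \<times>\<times> A)"
    by (auto simp: hom_def cyclic_power_def)
  show "bij_betw (Pair (\<lambda>_. undefined)) (carrier A) (carrier (cyclic_power n 0 \<times>\<times> A))"
    by (rule bij_betw_byWitness[where f' = snd]) (auto simp: cyclic_power_def)
qed

text \<open>The conclusions restate the assumptions for \<open>c2_ext R\<close>, with (t, 0) as the
  inverse of 2 and doubled exponents, so the lemma applies to its own result.\<close>

lemma (in cring) units_of_c2_ext_split:
  assumes t: "t \<in> carrier R" "t \<otimes> (\<one> \<oplus> \<one>) \<ominus> \<one> = \<zero>"
    and U: "units_of R \<cong> cyclic_power n a \<times>\<times> cyclic_power m b"
  shows "(t, \<zero>) \<in> carrier (c2_ext R)"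
    and "(t, \<zero>) \<otimes>\<^bsub>c2_ext R\<^esub> (\<one>\<^bsub>c2_ext R\<^esub> \<oplus>\<^bsub>c2_ext R\<^esub> \<one>\<^bsub>c2_ext R\<^esub>) \<ominus>\<^bsub>c2_ext R\<^esub> \<one>\<^bsub>c2_ext R\<^esub> =
      \<zero>\<^bsub>c2_ext R\<^esub>"
    and "units_of (c2_ext R) \<cong> cyclic_power n (a + a) \<times>\<times> cyclic_power m (b + b)"
proof -
  show "(t, \<zero>) \<in> carrier (c2_ext R)" using t by simp
  interpret Q: cring "c2_ext R" by (rule cring_c2_ext)
  have "t \<otimes> (\<one> \<oplus> \<one>) = \<one>" using t by (simp add: r_right_minus_eq)
  then have "(t, \<zero>) \<otimes>\<^bsub>c2_ext R\<^esub> (\<one>\<^bsub>c2_ext R\<^esub> \<oplus>\<^bsub>c2_ext R\<^esub> \<one>\<^bsub>c2_ext R\<^esub>) = \<one>\<^bsub>c2_ext R\<^esub>"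
    using t(1) by simp
  then show "(t, \<zero>) \<otimes>\<^bsub>c2_ext R\<^esub> (\<one>\<^bsub>c2_ext R\<^esub> \<oplus>\<^bsub>c2_ext R\<^esub> \<one>\<^bsub>c2_ext R\<^esub>) \<ominus>\<^bsub>c2_ext R\<^esub> \<one>\<^bsub>c2_ext R\<^esub> =
      \<zero>\<^bsub>c2_ext R\<^esub>"
    by (simp only: Q.r_right_minus_eq Q.one_closed)
  show "units_of (c2_ext R) \<cong> cyclic_power n (a + a) \<times>\<times> cyclic_power m (b + b)"
    by (rule iso_trans[OF iso_trans[OF iso_trans[OF units_of_quad_ext_split[OF t]
        DirProd_cong[OF U U]] DirProd_swap4] DirProd_cong[OF cyclic_power_add_sym cyclic_power_add_sym]])
qed

text \<open>Two moduli cover all odd cases: q - 1 with q^2 - 1, or q - 1 with 3 in characteristic 3.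
  Where q - 1 occurs alone, the second exponent is 0.\<close>

lemma (in cring) units_of_c2_tower_split:
  assumes t: "t \<in> carrier R" "t \<otimes> (\<one> \<oplus> \<one>) \<ominus> \<one> = \<zero>"
    and U: "units_of R \<cong> cyclic_power n a \<times>\<times> cyclic_power m b"
  shows "units_of (c2_ext (c2_ext (c2_ext R))) \<cong> cyclic_power n (8 * a) \<times>\<times> cyclic_power m (8 * b)"
proof -
  note 1 = units_of_c2_ext_split[OF t U]
  note c1 = cring_c2_ext
  note 2 = cring.units_of_c2_ext_split[OF c1 1]
  note c2 = cring.cring_c2_ext[OF c1]
  \<comment> \<open>The left side is literally the exponent left by three doublings, as
    \<open>simp only\<close> requires.\<close>
  have "x + x + (x + x) + (x + x + (x + x)) = 8 * x" for x :: nat by simp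
  then show ?thesis
    using cring.units_of_c2_ext_split(3)[OF c2 2] by (simp only:)
qed

text \<open>Every element is killed by \<open>p\<close> because px = (p1)x. Rings are allowed
  because the result is applied on each level of the tower.\<close>

lemma (in cring) add_monoid_elementary:
  assumes "prime p" "[p] \<cdot> \<one> = \<zero>" "card (carrier R) = p ^ n"
  shows "add_monoid R \<cong> cyclic_power p n"
proof (rule comm_group.elementary_abelian_iso[OF a_comm_group assms(1)])
  fix x assume "x \<in> carrier (add_monoid R)"
  then have x: "x \<in> carrier R" by simp
  have "[p] \<cdot> x = ([p] \<cdot> \<one>) \<otimes> x"
    using x add_pow_ldistr[of \<one> x p] by simp
  then show "x [^]\<^bsub>add_monoid R\<^esub> p = \<one>\<^bsub>add_monoid R\<^esub>"
    using x assms(2) by (simp add: add_pow_def)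
qed (use assms in simp)

lemma (in cring) two_add_pow_one: "[(2::nat)] \<cdot> \<one> = \<one> \<oplus> \<one>"
  by (simp add: numeral_2_eq_2)

lemma (in cring) three_add_pow_one: "[(3::nat)] \<cdot> \<one> = \<one> \<oplus> \<one> \<oplus> \<one>"
  by (simp add: numeral_3_eq_3)

text \<open>Again in a form that applies to its own result: \<open>b\<close> measures the ring and
  doubles with it, \<open>a\<close> collects the additive groups met so far, and \<open>W\<close> is
  carried along unchanged.\<close>

lemma (in cring) units_of_c2_ext_char2:
  assumes two: "\<one> \<oplus> \<one> = \<zero>" and card: "card (carrier R) = 2 ^ b"
    and U: "units_of R \<cong> cyclic_power 2 a \<times>\<times> W"
  shows "\<one>\<^bsub>c2_ext R\<^esub> \<oplus>\<^bsub>c2_ext R\<^esub> \<one>\<^bsub>c2_ext R\<^esub> = \<zero>\<^bsub>c2_ext R\<^esub>"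
    and "card (carrier (c2_ext R)) = 2 ^ (b + b)"
    and "units_of (c2_ext R) \<cong> cyclic_power 2 (b + a) \<times>\<times> W"
proof -
  show "\<one>\<^bsub>c2_ext R\<^esub> \<oplus>\<^bsub>c2_ext R\<^esub> \<one>\<^bsub>c2_ext R\<^esub> = \<zero>\<^bsub>c2_ext R\<^esub>"
    using two by simp
  show "card (carrier (c2_ext R)) = 2 ^ (b + b)"
    by (simp add: card card_cartesian_product power_add)
  have E: "add_monoid R \<cong> cyclic_power 2 b"
    using two card by (intro add_monoid_elementary) (simp_all add: two_add_pow_one)
  have assoc: "cyclic_power 2 b \<times>\<times> cyclic_power 2 a \<times>\<times> W \<cong> (cyclic_power 2 b \<times>\<times> cyclic_power 2 a) \<times>\<times> W"
  proof (rule is_isoI, rule isoI)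
    show "(\<lambda>(x, y, z). ((x, y), z)) \<in> hom (cyclic_power 2 b \<times>\<times> cyclic_power 2 a \<times>\<times> W)
        ((cyclic_power 2 b \<times>\<times> cyclic_power 2 a) \<times>\<times> W)"
      by (auto simp: hom_def)
    show "bij_betw (\<lambda>(x, y, z). ((x, y), z)) (carrier (cyclic_power 2 b \<times>\<times> cyclic_power 2 a \<times>\<times> W))
        (carrier ((cyclic_power 2 b \<times>\<times> cyclic_power 2 a) \<times>\<times> W))"
      by (rule bij_betw_byWitness[where f' = "\<lambda>((x, y), z). (x, y, z)"]) auto
  qed
  show "units_of (c2_ext R) \<cong> cyclic_power 2 (b + a) \<times>\<times> W"
    by (rule iso_trans[OF iso_trans[OF iso_trans[OF iso_trans[OF units_of_quad_ext_char2[OF two] DirProd_commute_iso]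
        DirProd_cong[OF E U]] assoc] DirProd_cong[OF cyclic_power_add_sym iso_refl]])
qed

lemma (in cring) units_of_c2_tower_char2:
  assumes two: "\<one> \<oplus> \<one> = \<zero>" and card: "card (carrier R) = 2 ^ b"
    and U: "units_of R \<cong> W"
  shows "units_of (c2_ext (c2_ext (c2_ext R))) \<cong> cyclic_power 2 (7 * b) \<times>\<times> W"
proof -
  note 1 = units_of_c2_ext_char2[OF two card iso_trans[OF U DirProd_cyclic_power_0]]
  note c1 = cring_c2_ext
  note 2 = cring.units_of_c2_ext_char2[OF c1 1]
  note c2 = cring.cring_c2_ext[OF c1]
  \<comment> \<open>The summands 4b, 2b and b come from the last, the middle and the first
    extension.\<close>
  have "b + b + (b + b) + (b + b + (b + 0)) = 7 * b" by simp
  then show ?thesis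
    using cring.units_of_c2_ext_char2(3)[OF c2 2] by (simp only:)
qed

section \<open>Units of F[C_3] over a finite field, and the assembly of the cases\<close>

lemma (in field) exists_inverse_minus_one:
  assumes "a \<in> carrier R" "a \<noteq> \<zero>"
  shows "\<exists>t\<in>carrier R. t \<otimes> a \<ominus> \<one> = \<zero>"
proof -
  have "a \<in> Units R" using assms field_Units by simp
  then show ?thesis
    by (intro bexI[of _ "inv a"]) (simp_all add: r_right_minus_eq)
qed

lemma (in field) units_of_cyc3_ext_cong_1:
  assumes fin: "finite (carrier R)" and card: "card (carrier R) mod 3 = 1"
    and three: "\<one> \<oplus> \<one> \<oplus> \<one> \<noteq> \<zero>"
  shows "units_of (cyc3_ext R) \<cong> cyclic_power (card (carrier R) - 1) 3"
proof -
  obtain t where t: "t \<in> carrier R" "t \<otimes> (\<one> \<oplus> \<one> \<oplus> \<one>) \<ominus> \<one> = \<zero>"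
    using exists_inverse_minus_one[OF _ three] by auto
  obtain \<omega> where \<omega>: "\<omega> \<in> carrier R" "\<omega> \<otimes> \<omega> \<oplus> \<omega> \<oplus> \<one> = \<zero>"
    using exists_omega[OF fin card] by blast
  let ?n = "card (carrier R) - 1"
  have U: "units_of R \<cong> cyclic_power ?n 1"
    by (rule iso_trans[OF units_of_iso_cyclic[OF fin] integer_mod_group_cyclic_power_1])
  have "units_of R \<times>\<times> units_of R \<cong> cyclic_power ?n (1 + 1)"
    by (rule iso_trans[OF DirProd_cong[OF U U] cyclic_power_add_sym])
  then have "units_of (quad_ext R (\<ominus> \<one>) (\<ominus> \<one>)) \<cong> cyclic_power ?n (1 + 1)"
    by (rule iso_trans[OF units_of_quad_ext_omega[OF \<omega>(1) t(1) \<omega>(2) t(2)]])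
  then have "units_of (cyc3_ext R) \<cong> cyclic_power ?n (1 + (1 + 1))"
    by (rule iso_trans[OF iso_trans[OF units_of_cyc3_ext_split[OF t] DirProd_cong[OF U]] cyclic_power_add_sym])
  then show ?thesis by (simp add: numeral_3_eq_3)
qed

lemma (in field) units_of_cyc3_ext_cong_2:
  assumes fin: "finite (carrier R)" and card: "card (carrier R) mod 3 = 2"
    and three: "\<one> \<oplus> \<one> \<oplus> \<one> \<noteq> \<zero>"
  shows "units_of (cyc3_ext R) \<cong>
    integer_mod_group (card (carrier R) - 1) \<times>\<times> integer_mod_group (card (carrier R) ^ 2 - 1)"
proof -
  obtain t where t: "t \<in> carrier R" "t \<otimes> (\<one> \<oplus> \<one> \<oplus> \<one>) \<ominus> \<one> = \<zero>"
    using exists_inverse_minus_one[OF _ three] by auto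
  let ?Q = "quad_ext R (\<ominus> \<one>) (\<ominus> \<one>)"
  have "field ?Q"
    by (rule quad_ext_field) (rule no_omega[OF fin card three])
  then have "units_of ?Q \<cong> integer_mod_group (card (carrier ?Q) - 1)"
    using fin by (intro field.units_of_iso_cyclic) simp_all
  moreover have "card (carrier ?Q) = card (carrier R) ^ 2"
    by (simp add: card_cartesian_product monoid_mult_class.power2_eq_square)
  ultimately have "units_of ?Q \<cong> integer_mod_group (card (carrier R) ^ 2 - 1)"
    by (simp only:)
  then show ?thesis
    by (rule iso_trans[OF units_of_cyc3_ext_split[OF t] DirProd_cong[OF units_of_iso_cyclic[OF fin]]])
qed

lemma (in cring) cyc3_ext_inverse_two:
  assumes t: "t \<in> carrier R" "t \<otimes> (\<one> \<oplus> \<one>) \<ominus> \<one> = \<zero>"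
  shows "(t, \<zero>, \<zero>) \<in> carrier (cyc3_ext R)"
    and "(t, \<zero>, \<zero>) \<otimes>\<^bsub>cyc3_ext R\<^esub> (\<one>\<^bsub>cyc3_ext R\<^esub> \<oplus>\<^bsub>cyc3_ext R\<^esub> \<one>\<^bsub>cyc3_ext R\<^esub>) \<ominus>\<^bsub>cyc3_ext R\<^esub> \<one>\<^bsub>cyc3_ext R\<^esub> =
      \<zero>\<^bsub>cyc3_ext R\<^esub>"
proof -
  show "(t, \<zero>, \<zero>) \<in> carrier (cyc3_ext R)" using t by simp
  interpret Q: cring "cyc3_ext R" by (rule cyc3_ext_cring)
  have "t \<otimes> (\<one> \<oplus> \<one>) = \<one>" using t by (simp add: r_right_minus_eq)
  then have "(t, \<zero>, \<zero>) \<otimes>\<^bsub>cyc3_ext R\<^esub> (\<one>\<^bsub>cyc3_ext R\<^esub> \<oplus>\<^bsub>cyc3_ext R\<^esub> \<one>\<^bsub>cyc3_ext R\<^esub>) = \<one>\<^bsub>cyc3_ext R\<^esub>"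
    using t(1) by simp
  then show "(t, \<zero>, \<zero>) \<otimes>\<^bsub>cyc3_ext R\<^esub> (\<one>\<^bsub>cyc3_ext R\<^esub> \<oplus>\<^bsub>cyc3_ext R\<^esub> \<one>\<^bsub>cyc3_ext R\<^esub>) \<ominus>\<^bsub>cyc3_ext R\<^esub> \<one>\<^bsub>cyc3_ext R\<^esub> =
      \<zero>\<^bsub>cyc3_ext R\<^esub>"
    by (simp only: Q.r_right_minus_eq Q.one_closed)
qed

text \<open>A positive value rules out the default 0, so \<open>p\<close> is a genuine minimum.
  Minimality later shows that 2 is nonzero for p > 2 and 3 is nonzero for p > 3.\<close>

lemma ring_char_add_pow:
  assumes "ring_char R = p" "p > 0"
  shows "[p] \<cdot>\<^bsub>R\<^esub> \<one>\<^bsub>R\<^esub> = \<zero>\<^bsub>R\<^esub>"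
    and "\<And>n. \<lbrakk>0 < n; n < p\<rbrakk> \<Longrightarrow> [n] \<cdot>\<^bsub>R\<^esub> \<one>\<^bsub>R\<^esub> \<noteq> \<zero>\<^bsub>R\<^esub>"
proof -
  let ?P = "\<lambda>n::nat. n > 0 \<and> [n] \<cdot>\<^bsub>R\<^esub> \<one>\<^bsub>R\<^esub> = \<zero>\<^bsub>R\<^esub>"
  have ex: "\<exists>n. ?P n" and p: "p = Least ?P"
    using assms by (auto simp: ring_char_def split: if_splits)
  show "[p] \<cdot>\<^bsub>R\<^esub> \<one>\<^bsub>R\<^esub> = \<zero>\<^bsub>R\<^esub>"
    using LeastI_ex[OF ex] unfolding p by blast
  show "[n] \<cdot>\<^bsub>R\<^esub> \<one>\<^bsub>R\<^esub> \<noteq> \<zero>\<^bsub>R\<^esub>" if "0 < n" "n < p" for n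
    using not_less_Least[of n ?P] that unfolding p by blast
qed

theorem theorem2p3:
  fixes F :: "('a, 'm) ring_scheme"
    and G :: "('g, 'n) monoid_scheme"
    and p k q :: nat
  assumes "field F" and "finite (carrier F)"
    and "ring_char F = p"
    and "card (carrier F) = q" and "q = p ^ k"
    and "group G"
    and "G \<cong> cyclic_power 2 3 \<times>\<times> integer_mod_group 3"
  shows
    "(p = 2 \<longrightarrow>
        ([q = 1] (mod 3) \<longrightarrow>
           units_of (group_algebra F G) \<cong>
             cyclic_power 2 (21 * k) \<times>\<times> cyclic_power (2 ^ k - 1) 3) \<and>
        ([int q = - 1] (mod 3) \<longrightarrow>
           units_of (group_algebra F G) \<cong>
             cyclic_power 2 (21 * k) \<times>\<times> integer_mod_group (2 ^ k - 1)
               \<times>\<times> integer_mod_group (2 ^ (2 * k) - 1))) \<and>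
     (p = 3 \<longrightarrow>
        units_of (group_algebra F G) \<cong>
          cyclic_power 3 (16 * k) \<times>\<times> cyclic_power (3 ^ k - 1) 8) \<and>
     (p > 3 \<longrightarrow>
        ([q = 1] (mod 6) \<longrightarrow>
           units_of (group_algebra F G) \<cong> cyclic_power (p ^ k - 1) 24) \<and>
        ([int q = - 1] (mod 6) \<longrightarrow>
           units_of (group_algebra F G) \<cong>
             cyclic_power (p ^ k - 1) 8 \<times>\<times> cyclic_power (p ^ (2 * k) - 1) 8))"
proof -
  interpret F: field F by fact
  let ?S = "cyc3_ext F"
  interpret S: cring ?S by (rule F.cyc3_ext_cring)
  note fin = \<open>finite (carrier F)\<close>
  have qk: "card (carrier F) = p ^ k" using assms by simp
  have card_S: "card (carrier ?S) = p ^ (3 * k)"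
    by (simp add: card_cartesian_product qk power_mult power3_eq_cube power_mult_distrib mult.commute[of 3])
  have sq: "card (carrier F) ^ 2 = p ^ (2 * k)"
    by (simp add: qk power_mult[symmetric] mult.commute)
  note tower = F.units_of_group_algebra_tower[OF \<open>group G\<close> assms(7)]
  have U: "units_of F \<cong> cyclic_power (p ^ k - 1) 1"
    using iso_trans[OF F.units_of_iso_cyclic[OF fin] integer_mod_group_cyclic_power_1] by (simp only: qk)
  note two = F.two_add_pow_one and three = F.three_add_pow_one
  \<comment> \<open>For p > 2 the upper part of the tower is the same; p = 3 and p > 3 differ only
    in the units of F[C_3].\<close>
  have odd_case: "units_of (group_algebra F G) \<cong> cyclic_power n (8 * a) \<times>\<times> cyclic_power m (8 * b)"
    if p: "p > 2" and US: "units_of ?S \<cong> cyclic_power n a \<times>\<times> cyclic_power m b" for n a m b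
  proof -
    have "\<one>\<^bsub>F\<^esub> \<oplus>\<^bsub>F\<^esub> \<one>\<^bsub>F\<^esub> \<noteq> \<zero>\<^bsub>F\<^esub>"
      using ring_char_add_pow(2)[OF assms(3), of 2] p by (simp add: two)
    then obtain t where t: "t \<in> carrier F" "t \<otimes>\<^bsub>F\<^esub> (\<one>\<^bsub>F\<^esub> \<oplus>\<^bsub>F\<^esub> \<one>\<^bsub>F\<^esub>) \<ominus>\<^bsub>F\<^esub> \<one>\<^bsub>F\<^esub> = \<zero>\<^bsub>F\<^esub>"
      using F.exists_inverse_minus_one[of "\<one>\<^bsub>F\<^esub> \<oplus>\<^bsub>F\<^esub> \<one>\<^bsub>F\<^esub>"] by auto
    show ?thesis
      by (rule iso_trans[OF tower S.units_of_c2_tower_split[OF F.cyc3_ext_inverse_two[OF t] US]])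
  qed
  have three_neq: "\<one>\<^bsub>F\<^esub> \<oplus>\<^bsub>F\<^esub> \<one>\<^bsub>F\<^esub> \<oplus>\<^bsub>F\<^esub> \<one>\<^bsub>F\<^esub> \<noteq> \<zero>\<^bsub>F\<^esub>" if "p = 2 \<or> p > 3"
    using that
  proof
    assume "p = 2"
    then have "\<one>\<^bsub>F\<^esub> \<oplus>\<^bsub>F\<^esub> \<one>\<^bsub>F\<^esub> = \<zero>\<^bsub>F\<^esub>"
      using ring_char_add_pow(1)[OF assms(3)] by (simp add: two)
    then show ?thesis by simp
  next
    assume "p > 3"
    then show ?thesis
      using ring_char_add_pow(2)[OF assms(3), of 3] by (simp add: three)
  qed
  have split: "units_of ?S \<cong> cyclic_power (p ^ k - 1) 3" if "q mod 3 = 1" "p = 2 \<or> p > 3"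
    using F.units_of_cyc3_ext_cong_1[OF fin _ three_neq[OF that(2)]] that(1) assms(4,5) by simp
  have nonsplit: "units_of ?S \<cong> integer_mod_group (p ^ k - 1) \<times>\<times> integer_mod_group (p ^ (2 * k) - 1)"
    if "q mod 3 = 2" "p = 2 \<or> p > 3"
    using F.units_of_cyc3_ext_cong_2[OF fin _ three_neq[OF that(2)]] that(1) assms(4,5) qk
    unfolding sq by simp
  show ?thesis
  proof (intro conjI impI)
    assume p: "p = 2"
    have "\<one>\<^bsub>F\<^esub> \<oplus>\<^bsub>F\<^esub> \<one>\<^bsub>F\<^esub> = \<zero>\<^bsub>F\<^esub>"
      using ring_char_add_pow(1)[OF assms(3)] p by (simp add: two)
    then have two_S: "\<one>\<^bsub>?S\<^esub> \<oplus>\<^bsub>?S\<^esub> \<one>\<^bsub>?S\<^esub> = \<zero>\<^bsub>?S\<^esub>"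
      by simp
    have k: "7 * (3 * k) = 21 * k" by simp
    note even = iso_trans[OF tower S.units_of_c2_tower_char2[OF two_S card_S[unfolded p]], unfolded k]
    show "units_of (group_algebra F G) \<cong> cyclic_power 2 (21 * k) \<times>\<times> cyclic_power (2 ^ k - 1) 3"
      if "[q = 1] (mod 3)"
      using that split p by (intro even) (simp add: cong_def)
    show "units_of (group_algebra F G) \<cong>
        cyclic_power 2 (21 * k) \<times>\<times> integer_mod_group (2 ^ k - 1) \<times>\<times> integer_mod_group (2 ^ (2 * k) - 1)"
      if "[int q = - 1] (mod 3)"
    proof -
      \<comment> \<open>The congruence with -1 lives in the integers; reduction gives the residue 2,
        which is then read back in the naturals.\<close>
      have "int (q mod 3) = 2" using that by (simp add: cong_def zmod_int)
      then have "q mod 3 = 2" by simp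
      then show ?thesis using nonsplit p by (intro even) simp
    qed
  next
    assume p: "p = 3"
    have three_F: "\<one>\<^bsub>F\<^esub> \<oplus>\<^bsub>F\<^esub> \<one>\<^bsub>F\<^esub> \<oplus>\<^bsub>F\<^esub> \<one>\<^bsub>F\<^esub> = \<zero>\<^bsub>F\<^esub>"
      using ring_char_add_pow(1)[OF assms(3)] p by (simp add: three)
    have E: "add_monoid F \<cong> cyclic_power 3 k"
      using three_F qk p by (intro F.add_monoid_elementary) (simp_all add: three)
    have "units_of ?S \<cong> cyclic_power (3 ^ k - 1) 1 \<times>\<times> cyclic_power 3 (k + k)"
      by (rule iso_trans[OF F.units_of_cyc3_ext_char3[OF three_F] DirProd_cong[OF U[unfolded p]
            iso_trans[OF DirProd_cong[OF E E] cyclic_power_add_sym]]])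
    then have "units_of (group_algebra F G) \<cong>
        cyclic_power (3 ^ k - 1) (8 * 1) \<times>\<times> cyclic_power 3 (8 * (k + k))"
      using p by (intro odd_case) simp_all
    then have "units_of (group_algebra F G) \<cong>
        cyclic_power 3 (8 * (k + k)) \<times>\<times> cyclic_power (3 ^ k - 1) (8 * 1)"
      by (rule iso_trans[OF _ DirProd_commute_iso])
    moreover have "8 * (k + k) = 16 * k" "8 * 1 = (8::nat)" by simp_all
    ultimately show "units_of (group_algebra F G) \<cong> cyclic_power 3 (16 * k) \<times>\<times> cyclic_power (3 ^ k - 1) 8"
      by (simp only:)
  next
    assume p: "p > 3"
    show "units_of (group_algebra F G) \<cong> cyclic_power (p ^ k - 1) 24" if q: "[q = 1] (mod 6)"
    proof -
      have "q mod 3 = 1" using q unfolding cong_def by presburger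
      \<comment> \<open>The summand 0 splits off a trivial second factor, which gives the two-factor
        shape expected by \<open>odd_case\<close>.\<close>
      then have "units_of ?S \<cong> cyclic_power (p ^ k - 1) (3 + 0)"
        using split p by simp
      then have "units_of ?S \<cong> cyclic_power (p ^ k - 1) 3 \<times>\<times> cyclic_power (p ^ k - 1) 0"
        by (rule iso_trans[OF _ cyclic_power_add])
      then have "units_of (group_algebra F G) \<cong>
          cyclic_power (p ^ k - 1) (8 * 3) \<times>\<times> cyclic_power (p ^ k - 1) (8 * 0)"
        using p by (intro odd_case) simp_all
      then have "units_of (group_algebra F G) \<cong> cyclic_power (p ^ k - 1) (8 * 3 + 8 * 0)"
        by (rule iso_trans[OF _ cyclic_power_add_sym])
      then show ?thesis by simp
    qed
    show "units_of (group_algebra F G) \<cong> cyclic_power (p ^ k - 1) 8 \<times>\<times> cyclic_power (p ^ (2 * k) - 1) 8"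
      if q: "[int q = - 1] (mod 6)"
    proof -
      \<comment> \<open>Residue 5 modulo 6 gives residue 2 modulo 3, the case in which \<omega> is
        not in F.\<close>
      have "int (q mod 6) = 5" using q by (simp add: cong_def zmod_int)
      then have "q mod 3 = 2" by presburger
      then have "units_of ?S \<cong> integer_mod_group (p ^ k - 1) \<times>\<times> integer_mod_group (p ^ (2 * k) - 1)"
        using nonsplit p by simp
      then have "units_of ?S \<cong> cyclic_power (p ^ k - 1) 1 \<times>\<times> cyclic_power (p ^ (2 * k) - 1) 1"
        by (rule iso_trans[OF _ DirProd_cong[OF integer_mod_group_cyclic_power_1 integer_mod_group_cyclic_power_1]])
      then have "units_of (group_algebra F G) \<cong>
          cyclic_power (p ^ k - 1) (8 * 1) \<times>\<times> cyclic_power (p ^ (2 * k) - 1) (8 * 1)"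
        using p by (intro odd_case) simp_all
      then show ?thesis by simp
    qed
  qed
qed

end
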